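(* (a) Let $n$ be prime and let $\boldsymbol{h}^A\in\mathbb{C}^n$ be the Alltop window, $h^A_q=\frac{1}{\sqrt n}e^{2\pi i q^3/n}$, $q=0,\dots,n-1$. If $k<\frac{\sqrt n+1}{2}$, then Basis Pursuit recovers from $\Gamma\boldsymbol{h}^A$ all matrices $\Gamma\in\mathbb{C}^{n\times n}$ having a $k$-sparse representation $\Gamma=\sum_{(p,\ell)\in\Lambda}x_{p\ell}\boldsymbol{M}_\ell\boldsymbol{T}_p$, $|\Lambda|=k$, with respect to the time-frequency shift dictionary $\mathcal{G}=\{\boldsymbol{M}_\ell\boldsymbol{T}_p:\ \ell,p=0,\dots,n-1\}$. (b) Let $n$ be even and let $\boldsymbol{h}^R\in\mathbb{C}^n$ be the random window with entries $h^R_q=\frac{1}{\sqrt n}\epsilon_q$, $q=0,\dots,n-1$, where the $\epsilon_q$ are independent and uniformly distributed on the torus $\{z\in\mathbb{C}:|z|=1\}$. Let $t>0$ and suppose $$k\le\frac14\sqrt{\frac{n}{2\log n+\log4+t}}+\frac12 .$$ Then with probability at least $1-e^{-t}$ Basis Pursuit recovers from $\Gamma\boldsymbol{h}^R$ all matrices $\Gamma\in\mathbb{C}^{n\times n}$ having a $k$-sparse representation with respect to the time-frequency shift dictionary $\mathcal{G}$.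
   Context: On $\mathbb{C}^n$ (indices $q=0,\dots,n-1$, understood modulo $n$) the translation and modulation operators are $(\boldsymbol{T}_p\boldsymbol{h})_q=h_{(p+q)\bmod n}$ and $(\boldsymbol{M}_\ell\boldsymbol{h})_q=e^{2\pi i\ell q/n}h_q$. The $n^2$ matrices in $\mathcal{G}$ form a basis of $\mathbb{C}^{n\times n}$. A matrix $\Gamma$ has a $k$-sparse representation with respect to $\mathcal{G}$ if $\Gamma=\sum_{\ell,p}x_{\ell p}\boldsymbol{M}_\ell\boldsymbol{T}_p$ where $\boldsymbol{x}$ has exactly $k$ non-zero entries. For a window $\boldsymbol{h}$, $(\mathcal{G}\boldsymbol{h})$ is the $n\times n^2$ matrix with columns $\boldsymbol{M}_\ell\boldsymbol{T}_p\boldsymbol{h}$, so $\Gamma\boldsymbol{h}=(\mathcal{G}\boldsymbol{h})\boldsymbol{x}$. Basis Pursuit is the program: $\min\|\boldsymbol{x}'\|_1$ subject to $(\mathcal{G}\boldsymbol{h})\boldsymbol{x}'=\Gamma\boldsymbol{h}$, where $\|\boldsymbol{x}'\|_1$ is the sum of the moduli of the entries. It recovers $\Gamma$ from $\Gamma\boldsymbol{h}$ if the coefficient vector $\boldsymbol{x}$ of $\Gamma$ is its unique solution. In (b) the event is that recovery holds simultaneously for all $k$-sparse $\Gamma$. $k$ is a positive integer and $\log$ is the natural logarithm.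
   Formalization: Part (a) is stated for primes n ≥ 5: for n = 2 and n = 3 the only admissible k is 1 and the claim fails, since q³ ≡ q mod n makes T_1 h^A a scalar multiple of h^A, so Γ = Id is not the unique minimiser. *)

theory Defs
  imports "HOL-Probability.Probability" "Jordan_Normal_Form.Matrix"
begin

hide_const (open) Finite_Cartesian_Product.vec Finite_Cartesian_Product.mat
hide_type (open) Finite_Cartesian_Product.vec
unbundle no vec_syntax

section \<open>Time-frequency shifts\<close>

definition trans_op :: "nat \<Rightarrow> nat \<Rightarrow> complex mat" where
  "trans_op n p = mat n n (\<lambda>(q, r). if r = (p + q) mod n then 1 else 0)"

definition mod_op :: "nat \<Rightarrow> nat \<Rightarrow> complex mat" where
  "mod_op n l = mat n n
     (\<lambda>(q, r). if q = r then exp (2 * of_real pi * \<i> * of_nat l * of_nat q / of_nat n) else 0)"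

definition tf_shift :: "nat \<Rightarrow> nat \<Rightarrow> nat \<Rightarrow> complex mat" where
  "tf_shift n l p = mod_op n l * trans_op n p"

text \<open>Coefficient arrays \<open>(x\<^sub>l\<^sub>p)\<close> with \<open>l, p < n\<close> are stored as vectors of length \<open>n * n\<close>;
  the entry for the pair \<open>(l, p)\<close> sits at position \<open>l * n + p\<close>. The columns of \<open>tf_matrix\<close>
  follow the same order.\<close>

definition tf_synth :: "nat \<Rightarrow> complex vec \<Rightarrow> complex mat" where
  "tf_synth n x = mat n n
     (\<lambda>(q, r). \<Sum>l<n. \<Sum>p<n. x $ (l * n + p) * tf_shift n l p $$ (q, r))"

definition tf_matrix :: "nat \<Rightarrow> complex vec \<Rightarrow> complex mat" where
  "tf_matrix n h = mat_of_cols n (map (\<lambda>j. tf_shift n (j div n) (j mod n) *\<^sub>v h) [0..<n * n])"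

definition has_sparse_rep :: "nat \<Rightarrow> nat \<Rightarrow> complex mat \<Rightarrow> bool" where
  "has_sparse_rep n k \<Gamma> \<longleftrightarrow>
     (\<exists>x \<in> carrier_vec (n * n). card {j. j < n * n \<and> x $ j \<noteq> 0} = k \<and> \<Gamma> = tf_synth n x)"

text \<open>Well defined because the \<open>n\<^sup>2\<close> time-frequency shifts form a basis;
  see \<open>tf_synth_ex1\<close> below.\<close>

definition tf_coeffs :: "nat \<Rightarrow> complex mat \<Rightarrow> complex vec" where
  "tf_coeffs n \<Gamma> = (THE x. x \<in> carrier_vec (n * n) \<and> tf_synth n x = \<Gamma>)"


section \<open>Basis Pursuit\<close>

definition l1_norm :: "complex vec \<Rightarrow> real" where
  "l1_norm x = (\<Sum>j<dim_vec x. cmod (x $ j))"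

definition bp_feasible :: "complex mat \<Rightarrow> complex vec \<Rightarrow> complex vec set" where
  "bp_feasible A b = {x \<in> carrier_vec (dim_col A). A *\<^sub>v x = b}"

definition bp_solutions :: "complex mat \<Rightarrow> complex vec \<Rightarrow> complex vec set" where
  "bp_solutions A b = {x \<in> bp_feasible A b. \<forall>y \<in> bp_feasible A b. l1_norm x \<le> l1_norm y}"

definition bp_recovers :: "nat \<Rightarrow> complex vec \<Rightarrow> complex mat \<Rightarrow> bool" where
  "bp_recovers n h \<Gamma> \<longleftrightarrow> bp_solutions (tf_matrix n h) (\<Gamma> *\<^sub>v h) = {tf_coeffs n \<Gamma>}"

definition bp_recovers_all_sparse :: "nat \<Rightarrow> nat \<Rightarrow> complex vec \<Rightarrow> bool" where
  "bp_recovers_all_sparse n k h \<longleftrightarrow>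
     (\<forall>\<Gamma> \<in> carrier_mat n n. has_sparse_rep n k \<Gamma> \<longrightarrow> bp_recovers n h \<Gamma>)"


section \<open>The two windows\<close>

text \<open>For \<open>n = 2\<close> and \<open>n = 3\<close> one has \<open>q\<^sup>3 \<equiv> q (mod n)\<close>, so all translates of the Alltop window
  are collinear; the window is only useful for primes \<open>n \<ge> 5\<close>.\<close>

definition alltop_window :: "nat \<Rightarrow> complex vec" where
  "alltop_window n = vec n
     (\<lambda>q. 1 / of_real (sqrt (real n)) * exp (2 * of_real pi * \<i> * of_nat q ^ 3 / of_nat n))"

definition torus_uniform :: "complex measure" where
  "torus_uniform = distr (uniform_measure lborel {0..2 * pi}) borel cis"

definition random_window :: "nat \<Rightarrow> (nat \<Rightarrow> 'w \<Rightarrow> complex) \<Rightarrow> 'w \<Rightarrow> complex vec" where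
  "random_window n \<epsilon> \<omega> = vec n (\<lambda>q. 1 / of_real (sqrt (real n)) * \<epsilon> q \<omega>)"


section \<open>Basic facts\<close>

lemma trans_op_apply:
  assumes "h \<in> carrier_vec n" "q < n"
  shows "(trans_op n p *\<^sub>v h) $ q = h $ ((p + q) mod n)"
proof -
  have "(trans_op n p *\<^sub>v h) $ q = (\<Sum>r = 0..<n. (if r = (p + q) mod n then 1 else 0) * h $ r)"
    using assms by (auto simp: trans_op_def scalar_prod_def)
  also have "\<dots> = (\<Sum>r = 0..<n. if r = (p + q) mod n then h $ r else 0)"
    by (intro sum.cong) auto
  also have "\<dots> = h $ ((p + q) mod n)"
    using assms by (subst sum.delta) auto
  finally show ?thesis .
qed

lemma mod_op_apply:
  assumes "h \<in> carrier_vec n" "q < n"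
  shows "(mod_op n l *\<^sub>v h) $ q = exp (2 * of_real pi * \<i> * of_nat l * of_nat q / of_nat n) * h $ q"
proof -
  let ?e = "exp (2 * of_real pi * \<i> * of_nat l * of_nat q / of_nat n)"
  have "(mod_op n l *\<^sub>v h) $ q = (\<Sum>r = 0..<n. (if q = r then ?e else 0) * h $ r)"
    using assms by (auto simp: mod_op_def scalar_prod_def)
  also have "\<dots> = (\<Sum>r = 0..<n. if q = r then ?e * h $ r else 0)"
    by (intro sum.cong) auto
  also have "\<dots> = ?e * h $ q"
    using assms by (subst sum.delta') auto
  finally show ?thesis .
qed

lemma tf_shift_index:
  assumes "q < n" "r < n"
  shows "tf_shift n l p $$ (q, r) =
    (if r = (p + q) mod n then exp (2 * of_real pi * \<i> * of_nat l * of_nat q / of_nat n) else 0)"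
proof -
  have dims: "dim_row (mod_op n l) = n" "dim_col (trans_op n p) = n" "dim_row (trans_op n p) = n"
    by (simp_all add: mod_op_def trans_op_def)
  have c: "col (trans_op n p) r \<in> carrier_vec n"
    by (rule carrier_vecI) (simp only: dim_col dims)
  have cq: "col (trans_op n p) r $ q = (if r = (p + q) mod n then 1 else 0)"
    using assms by (simp add: trans_op_def)
  have "tf_shift n l p $$ (q, r) = (mod_op n l *\<^sub>v col (trans_op n p) r) $ q"
    unfolding tf_shift_def using assms by (simp only: index_mult_mat index_mult_mat_vec dims)
  also have "\<dots> = exp (2 * of_real pi * \<i> * of_nat l * of_nat q / of_nat n) * col (trans_op n p) r $ q"
    by (simp only: mod_op_apply[OF c assms(1)])
  finally have eq: "tf_shift n l p $$ (q, r) =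
      exp (2 * of_real pi * \<i> * of_nat l * of_nat q / of_nat n) * col (trans_op n p) r $ q" .
  show ?thesis
  proof (cases "r = (p + q) mod n")
    case True
    then show ?thesis unfolding eq cq by (simp only: if_True simp_thms mult_1_right)
  next
    case False
    then show ?thesis unfolding eq cq by (simp only: if_False mult_zero_right)
  qed
qed

lemma character_orthogonality:
  fixes a b n :: nat
  assumes "a < n" "b < n"
  shows "(\<Sum>j<n. exp (2 * of_real pi * \<i> * of_nat j * of_nat a / of_nat n) *
            exp (- (2 * of_real pi * \<i> * of_nat j * of_nat b / of_nat n))) =
         (if a = b then of_nat n else (0 :: complex))"
proof -
  define z :: complex where "z = exp (2 * of_real pi * \<i> * (of_nat a - of_nat b) / of_nat n)"
  have n: "(of_nat n :: complex) \<noteq> 0" using assms by auto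
  have "(\<Sum>j<n. exp (2 * of_real pi * \<i> * of_nat j * of_nat a / of_nat n) *
            exp (- (2 * of_real pi * \<i> * of_nat j * of_nat b / of_nat n))) = (\<Sum>j<n. z ^ j)"
    unfolding z_def exp_of_nat_mult[symmetric] mult_exp_exp
    by (intro sum.cong refl arg_cong[where f = exp]) (simp add: field_simps n)
  also have "\<dots> = (if a = b then of_nat n else 0)"
  proof (cases "a = b")
    case True
    then show ?thesis by (simp add: z_def)
  next
    case False
    have zn: "z ^ n = 1"
    proof -
      have "z ^ n = exp (of_nat n * (2 * of_real pi * \<i> * (of_nat a - of_nat b) / of_nat n))"
        unfolding z_def by (rule exp_of_nat_mult[symmetric])
      also have "\<dots> = exp (2 * of_int (int a - int b) * of_real pi * \<i>)"
        using n by (intro arg_cong[where f = exp]) (simp add: field_simps)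
      also have "\<dots> = 1"
        unfolding exp_eq_1 by (intro conjI exI[of _ "int a - int b"]) auto
      finally show ?thesis .
    qed
    have "z \<noteq> 1"
    proof
      assume "z = 1"
      then obtain m :: int where
        "Im (2 * of_real pi * \<i> * (of_nat a - of_nat b) / of_nat n) = of_int (2 * m) * pi"
        unfolding z_def exp_eq_1 by blast
      moreover have "Im (2 * of_real pi * \<i> * (of_nat a - of_nat b) / of_nat n)
          = 2 * pi * (real a - real b) / real n"
        by (simp add: Im_divide_of_nat)
      ultimately have "2 * pi * (real a - real b) = 2 * pi * (of_int m * real n)"
        using n by (simp add: field_simps)
      then have "real a - real b = of_int m * real n"
        by (subst (asm) mult_cancel_left) simp
      then have "real_of_int (int a - int b) = real_of_int (m * int n)" by simp
      then have eq: "int a - int b = m * int n" by (rule of_int_eq_iff[THEN iffD1])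
      have "\<bar>int a - int b\<bar> < int n" using assms by linarith
      then have "\<bar>m\<bar> * int n < 1 * int n" using eq by (simp add: abs_mult)
      then have "\<bar>m\<bar> < 1" by (rule mult_right_less_imp_less) simp
      then show False using eq False by simp
    qed
    then show ?thesis using False zn by (simp add: geometric_sum)
  qed
  finally show ?thesis .
qed

lemma tf_synth_index:
  assumes "q < n" "p < n"
  shows "tf_synth n x $$ (q, (p + q) mod n) =
    (\<Sum>l<n. x $ (l * n + p) * exp (2 * of_real pi * \<i> * of_nat l * of_nat q / of_nat n))"
proof -
  have inj: "(p + q) mod n = (p' + q) mod n \<longleftrightarrow> p' = p" if "p' < n" for p'
  proof
    assume "(p + q) mod n = (p' + q) mod n"
    moreover have "(a + q) mod n = (if a + q < n then a + q else a + q - n)" if "a < n" for a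
      using that assms by (simp add: le_mod_geq)
    ultimately show "p' = p" using that assms by (auto split: if_splits)
  qed simp
  have r: "(p + q) mod n < n" using assms by auto
  have "tf_synth n x $$ (q, (p + q) mod n) =
      (\<Sum>l<n. \<Sum>p'<n. x $ (l * n + p') * tf_shift n l p' $$ (q, (p + q) mod n))"
    unfolding tf_synth_def using assms(1) r by (simp only: index_mat prod.case)
  also have "\<dots> = (\<Sum>l<n. \<Sum>p'<n. if p' = p then
         x $ (l * n + p') * exp (2 * of_real pi * \<i> * of_nat l * of_nat q / of_nat n) else 0)"
  proof (intro sum.cong refl)
    fix l p' assume "p' \<in> {..<n}"
    then have "p' < n" by simp
    show "x $ (l * n + p') * tf_shift n l p' $$ (q, (p + q) mod n) = (if p' = p then
         x $ (l * n + p') * exp (2 * of_real pi * \<i> * of_nat l * of_nat q / of_nat n) else 0)"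
      unfolding tf_shift_index[OF assms(1) r] inj[OF \<open>p' < n\<close>] by (cases "p' = p") simp_all
  qed
  also have "\<dots> =
      (\<Sum>l<n. x $ (l * n + p) * exp (2 * of_real pi * \<i> * of_nat l * of_nat q / of_nat n))"
    using assms by (simp only: sum.delta finite_lessThan lessThan_iff if_True)
  finally show ?thesis .
qed

lemma tf_synth_coeff:
  assumes "l < n" "p < n"
  shows "x $ (l * n + p) = (\<Sum>q<n. tf_synth n x $$ (q, (p + q) mod n) *
           exp (- (2 * of_real pi * \<i> * of_nat q * of_nat l / of_nat n))) / of_nat n"
proof -
  have "(\<Sum>q<n. tf_synth n x $$ (q, (p + q) mod n) *
           exp (- (2 * of_real pi * \<i> * of_nat q * of_nat l / of_nat n))) =
        (\<Sum>q<n. \<Sum>l'<n. x $ (l' * n + p) *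
           (exp (2 * of_real pi * \<i> * of_nat q * of_nat l' / of_nat n) *
           exp (- (2 * of_real pi * \<i> * of_nat q * of_nat l / of_nat n))))"
  proof (rule sum.cong[OF refl])
    fix q assume "q \<in> {..<n}"
    then have "q < n" by simp
    show "tf_synth n x $$ (q, (p + q) mod n) *
           exp (- (2 * of_real pi * \<i> * of_nat q * of_nat l / of_nat n)) =
        (\<Sum>l'<n. x $ (l' * n + p) *
           (exp (2 * of_real pi * \<i> * of_nat q * of_nat l' / of_nat n) *
           exp (- (2 * of_real pi * \<i> * of_nat q * of_nat l / of_nat n))))"
      unfolding tf_synth_index[OF \<open>q < n\<close> assms(2)] sum_distrib_right
      by (intro sum.cong refl) (simp only: mult_ac)
  qed
  also have "\<dots> = (\<Sum>l'<n. x $ (l' * n + p) * (\<Sum>q<n.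
           exp (2 * of_real pi * \<i> * of_nat q * of_nat l' / of_nat n) *
           exp (- (2 * of_real pi * \<i> * of_nat q * of_nat l / of_nat n))))"
    by (subst sum.swap) (simp add: sum_distrib_left)
  also have "\<dots> = (\<Sum>l'<n. if l' = l then x $ (l' * n + p) * of_nat n else 0)"
    using assms by (intro sum.cong refl) (auto simp: character_orthogonality)
  also have "\<dots> = x $ (l * n + p) * of_nat n"
    using assms by (simp add: sum.delta)
  finally show ?thesis using assms by simp
qed

lemma tf_synth_ex1:
  assumes "\<Gamma> \<in> carrier_mat n n"
  shows "\<exists>!x. x \<in> carrier_vec (n * n) \<and> tf_synth n x = \<Gamma>"
proof -
  define c :: "nat \<Rightarrow> nat \<Rightarrow> complex" where
    "c l p = (\<Sum>q<n. \<Gamma> $$ (q, (p + q) mod n) *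
           exp (- (2 * of_real pi * \<i> * of_nat q * of_nat l / of_nat n))) / of_nat n" for l p
  define x where "x = vec (n * n) (\<lambda>j. c (j div n) (j mod n))"
  have idx: "l * n + p < n * n" if "l < n" "p < n" for l p
  proof -
    have "l * n + p < Suc l * n" using that by simp
    also have "\<dots> \<le> n * n" using that by (intro mult_right_mono) auto
    finally show ?thesis .
  qed
  have x: "x $ (l * n + p) = c l p" if "l < n" "p < n" for l p
    using that idx[OF that] by (simp add: x_def)
  have ent: "tf_synth n x $$ (q, (p + q) mod n) = \<Gamma> $$ (q, (p + q) mod n)"
    if qp: "q < n" "p < n" for q p
  proof -
    have "tf_synth n x $$ (q, (p + q) mod n) =
        (\<Sum>l<n. c l p * exp (2 * of_real pi * \<i> * of_nat l * of_nat q / of_nat n))"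
      using qp by (simp add: tf_synth_index x)
    also have "\<dots> = (\<Sum>l<n. \<Sum>q'<n. \<Gamma> $$ (q', (p + q') mod n) / of_nat n *
        (exp (2 * of_real pi * \<i> * of_nat l * of_nat q / of_nat n) *
         exp (- (2 * of_real pi * \<i> * of_nat l * of_nat q' / of_nat n))))"
      unfolding c_def
      unfolding sum_divide_distrib sum_distrib_right
      by (intro sum.cong refl) (simp only: mult_ac times_divide_eq_left times_divide_eq_right)
    also have "\<dots> = (\<Sum>q'<n. \<Gamma> $$ (q', (p + q') mod n) / of_nat n * (\<Sum>l<n.
         exp (2 * of_real pi * \<i> * of_nat l * of_nat q / of_nat n) *
         exp (- (2 * of_real pi * \<i> * of_nat l * of_nat q' / of_nat n))))"
      by (subst sum.swap) (simp only: sum_distrib_left)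
    also have "\<dots> = (\<Sum>q'<n. if q' = q then \<Gamma> $$ (q', (p + q') mod n) else 0)"
      using qp by (intro sum.cong refl) (auto simp: character_orthogonality)
    finally show ?thesis using qp by (simp add: sum.delta)
  qed
  have synth: "tf_synth n x = \<Gamma>"
  proof (rule eq_matI)
    fix q r assume "q < dim_row \<Gamma>" "r < dim_col \<Gamma>"
    then have q: "q < n" and r: "r < n" using assms by auto
    define p where "p = (r + (n - q)) mod n"
    have p: "p < n" using q by (simp add: p_def)
    have "(p + q) mod n = (r + (n - q) + q) mod n"
      by (simp add: p_def mod_add_left_eq)
    also have "r + (n - q) + q = r + n" using q by simp
    finally have "(p + q) mod n = r" using r by simp
    with ent[OF q p] show "tf_synth n x $$ (q, r) = \<Gamma> $$ (q, r)" by simp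
  qed (use assms in \<open>auto simp: tf_synth_def\<close>)
  show ?thesis
  proof (rule ex1I[of _ x])
    show "x \<in> carrier_vec (n * n) \<and> tf_synth n x = \<Gamma>"
      using synth by (simp add: x_def)
  next
    fix y assume y: "y \<in> carrier_vec (n * n) \<and> tf_synth n y = \<Gamma>"
    show "y = x"
    proof (rule eq_vecI)
      fix j assume "j < dim_vec x"
      then have j: "j < n * n" by (simp add: x_def)
      then have n: "0 < n" by (cases n) auto
      have l: "j div n < n" and p: "j mod n < n"
        using j n by (auto simp: less_mult_imp_div_less)
      show "y $ j = x $ j"
        using tf_synth_coeff[OF l p, of y] tf_synth_coeff[OF l p, of x] synth y by simp
    qed (use y in \<open>auto simp: x_def\<close>)
  qed
qed

lemma tf_matrix_mult:
  assumes h: "h \<in> carrier_vec n" and x: "x \<in> carrier_vec (n * n)"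
  shows "tf_matrix n h *\<^sub>v x = tf_synth n x *\<^sub>v h"
proof (rule eq_vecI)
  fix q assume "q < dim_vec (tf_synth n x *\<^sub>v h)"
  then have q: "q < n" by (simp add: tf_synth_def)
  let ?g = "\<lambda>j. (tf_shift n (j div n) (j mod n) *\<^sub>v h) $ q * x $ j"
  have sh: "(tf_shift n l p *\<^sub>v h) $ q = (\<Sum>r<n. tf_shift n l p $$ (q, r) * h $ r)" for l p
    using h q
    by (auto simp: tf_shift_def mod_op_def trans_op_def scalar_prod_def atLeast0LessThan
             intro!: sum.cong)
  have "(tf_matrix n h *\<^sub>v x) $ q = (\<Sum>j<n * n. ?g j)"
    using q x by (simp add: tf_matrix_def mat_of_cols_def scalar_prod_def atLeast0LessThan
                       mult.commute)
  also have "\<dots> = (\<Sum>l<n. \<Sum>j\<in>{l * n..<l * n + n}. ?g j)"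
    by (rule sum.nat_group[symmetric])
  also have "\<dots> = (\<Sum>l<n. \<Sum>p<n. ?g (l * n + p))"
  proof (rule sum.cong[OF refl])
    fix l
    show "(\<Sum>j\<in>{l * n..<l * n + n}. ?g j) = (\<Sum>p<n. ?g (l * n + p))"
      using sum.shift_bounds_nat_ivl[of ?g 0 "l * n" n] by (simp add: atLeast0LessThan add.commute)
  qed
  also have "\<dots> = (\<Sum>l<n. \<Sum>p<n. (tf_shift n l p *\<^sub>v h) $ q * x $ (l * n + p))"
    using q by (intro sum.cong refl) auto
  also have "\<dots> = (\<Sum>l<n. \<Sum>p<n. \<Sum>r<n. x $ (l * n + p) * tf_shift n l p $$ (q, r) * h $ r)"
    unfolding sh sum_distrib_right by (intro sum.cong refl) (simp only: mult_ac)
  also have "\<dots> = (\<Sum>l<n. \<Sum>r<n. \<Sum>p<n. x $ (l * n + p) * tf_shift n l p $$ (q, r) * h $ r)"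
    by (intro sum.cong refl sum.swap)
  also have "\<dots> = (\<Sum>r<n. \<Sum>l<n. \<Sum>p<n. x $ (l * n + p) * tf_shift n l p $$ (q, r) * h $ r)"
    by (rule sum.swap)
  also have "\<dots> = (tf_synth n x *\<^sub>v h) $ q"
    using q h by (auto simp: tf_synth_def scalar_prod_def sum_distrib_right atLeast0LessThan
                       intro!: sum.cong)
  finally show "(tf_matrix n h *\<^sub>v x) $ q = (tf_synth n x *\<^sub>v h) $ q" .
qed (simp add: tf_synth_def tf_matrix_def)

end

theory Submission
  imports Defs "HOL-Number_Theory.Cong"
begin

text \<open>Basis Pursuit recovers every \<open>k\<close>-sparse vector as soon as the unit-norm columns of the
  measurement matrix have pairwise inner products below \<open>1 / (2 k - 1)\<close>, by way of the null space
  property. For time-frequency shifts these inner products are values of the ambiguity function of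
  the window. For the Alltop window they are quadratic Gauss sums, of modulus \<open>1 / sqrt n\<close>.

  For the random window they are chaoses
  \<open>n\<inverse> * (\<Sum>q. e(l * q / n) * \<epsilon>\<^sub>q\<^sub>+\<^sub>p * cnj \<epsilon>\<^sub>q)\<close>. Cutting the sum into two halves
  of \<open>m = n / 2\<close> terms removes all cycles, so that the \<open>2 j\<close>-th absolute moment of each half is
  at most \<open>j! * m ^ j\<close>, as for a complex Gaussian. Summing the exponential series gives a Gaussian
  tail, and a union bound over the shifts finishes the proof. The recovery event is measurable
  because the null space property is an open condition on the window.\<close>

section \<open>Null space property\<close>

text \<open>The index sets have exactly \<open>k\<close> elements because
  \<open>has_sparse_rep\<close> also fixes the number of non-zero entries; this makes the property
  equivalent to recovery.\<close>

definition null_space_property :: "complex mat \<Rightarrow> nat \<Rightarrow> bool" where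
  "null_space_property A k \<longleftrightarrow>
     (\<forall>v \<in> carrier_vec (dim_col A). \<forall>S \<subseteq> {..<dim_col A}.
        A *\<^sub>v v = 0\<^sub>v (dim_row A) \<longrightarrow> v \<noteq> 0\<^sub>v (dim_col A) \<longrightarrow> card S = k \<longrightarrow>
        2 * (\<Sum>j\<in>S. cmod (v $ j)) < l1_norm v)"

lemma l1_norm_split:
  assumes "S \<subseteq> {..<dim_vec v}"
  shows "l1_norm v = (\<Sum>j\<in>S. cmod (v $ j)) + (\<Sum>j\<in>{..<dim_vec v} - S. cmod (v $ j))"
  unfolding l1_norm_def using assms by (subst sum.subset_diff[of S]) auto

lemma mult_minus_distrib_mat_vec':
  fixes A :: "complex mat"
  assumes "x \<in> carrier_vec (dim_col A)" "y \<in> carrier_vec (dim_col A)"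
  shows "A *\<^sub>v (x - y) = A *\<^sub>v x - A *\<^sub>v y"
  using assms by (intro mult_minus_distrib_mat_vec[of _ "dim_row A" "dim_col A"]) auto

text \<open>A competitor \<open>y\<close> differs from \<open>x\<close> by a kernel vector, which
  has more mass off the support of \<open>x\<close> than on it. Off the support the difference is
  \<open>- y\<close>, so \<open>y\<close> gains more there than it can save on the support.\<close>

lemma null_space_property_recovery:
  assumes nsp: "null_space_property A k" and x: "x \<in> carrier_vec (dim_col A)"
    and card: "card {j. j < dim_col A \<and> x $ j \<noteq> 0} = k"
  shows "bp_solutions A (A *\<^sub>v x) = {x}"
proof -
  define S where "S = {j. j < dim_col A \<and> x $ j \<noteq> 0}"
  have S: "S \<subseteq> {..<dim_col A}" by (auto simp: S_def)
  have less: "l1_norm x < l1_norm y"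
    if y: "y \<in> carrier_vec (dim_col A)" "A *\<^sub>v y = A *\<^sub>v x" "y \<noteq> x" for y
  proof -
    have v: "x - y \<in> carrier_vec (dim_col A)" using x y by auto
    have "A *\<^sub>v (x - y) = 0\<^sub>v (dim_row A)"
      using x y by (subst mult_minus_distrib_mat_vec') auto
    moreover have "x - y \<noteq> 0\<^sub>v (dim_col A)"
    proof
      assume "x - y = 0\<^sub>v (dim_col A)"
      then have "(x - y) $ j = 0" if "j < dim_col A" for j using that by simp
      then have "y = x" using x y by (intro eq_vecI) auto
      with y show False by simp
    qed
    ultimately have "2 * (\<Sum>j\<in>S. cmod ((x - y) $ j)) < l1_norm (x - y)"
      using nsp v S card unfolding null_space_property_def S_def by blast
    also have "\<dots> = (\<Sum>j\<in>S. cmod ((x - y) $ j)) + (\<Sum>j\<in>{..<dim_col A} - S. cmod ((x - y) $ j))"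
      using y S by (subst l1_norm_split[of S]) auto
    finally have 1: "(\<Sum>j\<in>S. cmod ((x - y) $ j)) < (\<Sum>j\<in>{..<dim_col A} - S. cmod ((x - y) $ j))"
      by simp
    have 2: "(\<Sum>j\<in>{..<dim_col A} - S. cmod ((x - y) $ j)) = (\<Sum>j\<in>{..<dim_col A} - S. cmod (y $ j))"
      using x y by (intro sum.cong refl) (auto simp: S_def)
    have "l1_norm x = (\<Sum>j\<in>S. cmod (x $ j)) + (\<Sum>j\<in>{..<dim_col A} - S. cmod (x $ j))"
      using x S by (subst l1_norm_split[of S]) auto
    also have "(\<Sum>j\<in>{..<dim_col A} - S. cmod (x $ j)) = 0"
      by (intro sum.neutral) (auto simp: S_def)
    also have "(\<Sum>j\<in>S. cmod (x $ j)) \<le> (\<Sum>j\<in>S. cmod ((x - y) $ j) + cmod (y $ j))"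
    proof (rule sum_mono)
      fix j assume "j \<in> S"
      then have "(x - y) $ j = x $ j - y $ j" using x y S by auto
      then show "cmod (x $ j) \<le> cmod ((x - y) $ j) + cmod (y $ j)"
        using norm_triangle_ineq[of "x $ j - y $ j" "y $ j"] by simp
    qed
    also have "\<dots> = (\<Sum>j\<in>S. cmod ((x - y) $ j)) + (\<Sum>j\<in>S. cmod (y $ j))"
      by (rule sum.distrib)
    also have "\<dots> < (\<Sum>j\<in>S. cmod (y $ j)) + (\<Sum>j\<in>{..<dim_col A} - S. cmod (y $ j))"
      using 1 2 by simp
    also have "\<dots> = l1_norm y"
      using y S by (subst l1_norm_split[of S y]) auto
    finally show ?thesis by simp
  qed
  show ?thesis
  proof (intro equalityI subsetI)
    fix z assume "z \<in> bp_solutions A (A *\<^sub>v x)"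
    then have "z \<in> carrier_vec (dim_col A)" "A *\<^sub>v z = A *\<^sub>v x" "l1_norm z \<le> l1_norm x"
      using x by (auto simp: bp_solutions_def bp_feasible_def)
    with less[of z] show "z \<in> {x}" by force
  next
    fix z assume "z \<in> {x}"
    then show "z \<in> bp_solutions A (A *\<^sub>v x)"
      using x less by (force simp: bp_solutions_def bp_feasible_def)
  qed
qed

text \<open>The converse direction, which lets the recovery event be identified with the null space
  property when its measurability is proved. With \<open>x\<close> built from the restriction of
  \<open>v\<close> to \<open>S\<close>, both \<open>x\<close> and \<open>x - v\<close> are feasible,
  and the strict inequality between their norms is the claim.\<close>

lemma recovery_null_space_property:
  assumes rec: "\<And>x. x \<in> carrier_vec (dim_col A) \<Longrightarrow> card {j. j < dim_col A \<and> x $ j \<noteq> 0} = k \<Longrightarrow>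
      bp_solutions A (A *\<^sub>v x) = {x}"
  shows "null_space_property A k"
  unfolding null_space_property_def
proof (intro ballI allI impI)
  fix v S assume v: "v \<in> carrier_vec (dim_col A)" and S: "S \<subseteq> {..<dim_col A}"
    and ker: "A *\<^sub>v v = 0\<^sub>v (dim_row A)" and v0: "v \<noteq> 0\<^sub>v (dim_col A)" and card: "card S = k"
  \<comment> \<open>The support of \<open>v\<close> may miss part of \<open>S\<close>, but \<open>has_sparse_rep\<close> asks for exactly \<open>k\<close>
    non-zero entries; the gaps are filled with \<open>1\<close>.\<close>
  define x where
    "x = vec (dim_col A) (\<lambda>j. if j \<in> S then (if v $ j = 0 then 1 else v $ j) else 0)"
  have x: "x \<in> carrier_vec (dim_col A)" by (simp add: x_def)
  have "j < dim_col A \<and> x $ j \<noteq> 0 \<longleftrightarrow> j \<in> S" for j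
    using S by (cases "j < dim_col A") (auto simp: x_def)
  then have "{j. j < dim_col A \<and> x $ j \<noteq> 0} = S" by blast
  with rec[OF x] card have sol: "bp_solutions A (A *\<^sub>v x) = {x}" by simp
  have "A *\<^sub>v (x - v) = A *\<^sub>v x"
    using x v ker by (subst mult_minus_distrib_mat_vec') auto
  then have feas: "x - v \<in> bp_feasible A (A *\<^sub>v x)"
    using x v by (auto simp: bp_feasible_def)
  have less: "l1_norm x < l1_norm (x - v)"
  proof (rule ccontr)
    assume "\<not> ?thesis"
    moreover have "x \<in> bp_solutions A (A *\<^sub>v x)" using sol by simp
    ultimately have "x - v \<in> bp_solutions A (A *\<^sub>v x)"
      using feas unfolding bp_solutions_def by force
    then have "x - v = x" using sol by simp
    then have "(x - v) $ j = x $ j" for j by simp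
    then have "v $ j = 0" if "j < dim_col A" for j
      using that x v by (metis carrier_vecD index_minus_vec(1) diff_eq_eq add_cancel_right_right)
    then have "v = 0\<^sub>v (dim_col A)" using v by (intro eq_vecI) auto
    with v0 show False by simp
  qed
  have split: "l1_norm y = (\<Sum>j\<in>S. cmod (y $ j)) + (\<Sum>j\<in>{..<dim_col A} - S. cmod (y $ j))"
    if "y \<in> carrier_vec (dim_col A)" for y
    using that S l1_norm_split[of S y] by auto
  \<comment> \<open>Termwise: where \<open>v $ j\<close> is non-zero, \<open>x - v\<close> vanishes;
    where it is zero, both remaining moduli are the filler \<open>1\<close>. The fillers thus cancel
    from the comparison.\<close>
  have "(\<Sum>j\<in>S. cmod (v $ j)) + (\<Sum>j\<in>S. cmod ((x - v) $ j)) = (\<Sum>j\<in>S. cmod (x $ j))"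
    unfolding sum.distrib[symmetric] using S v by (intro sum.cong refl) (auto simp: x_def)
  moreover have "(\<Sum>j\<in>{..<dim_col A} - S. cmod (x $ j)) = 0"
    by (intro sum.neutral) (auto simp: x_def)
  moreover have "(\<Sum>j\<in>{..<dim_col A} - S. cmod ((x - v) $ j)) = (\<Sum>j\<in>{..<dim_col A} - S. cmod (v $ j))"
    using v by (intro sum.cong refl) (auto simp: x_def)
  moreover have "x - v \<in> carrier_vec (dim_col A)" using x v by auto
  ultimately show "2 * (\<Sum>j\<in>S. cmod (v $ j)) < l1_norm v"
    using less split[of x] split[of v] split[of "x - v"] x v by linarith
qed

section \<open>Recovery of sparse matrices as a condition on the measurement matrix\<close>

lemma dim_tf_matrix [simp]: "dim_row (tf_matrix n h) = n" "dim_col (tf_matrix n h) = n * n"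
  by (simp_all add: tf_matrix_def)

lemma tf_coeffs_tf_synth:
  assumes "x \<in> carrier_vec (n * n)"
  shows "tf_coeffs n (tf_synth n x) = x"
proof -
  have "tf_synth n x \<in> carrier_mat n n" by (simp add: tf_synth_def)
  from tf_synth_ex1[OF this] assms show ?thesis
    unfolding tf_coeffs_def by (intro the1_equality) auto
qed

text \<open>\<open>tf_coeffs\<close> inverts \<open>tf_synth\<close>, and applying the synthesized
  matrix to the window is applying \<open>tf_matrix\<close> to the coefficients. Quantifying over
  sparse matrices therefore amounts to quantifying over sparse coefficient vectors.\<close>

lemma bp_recovers_all_sparse_iff:
  assumes "h \<in> carrier_vec n"
  shows "bp_recovers_all_sparse n k h \<longleftrightarrow> null_space_property (tf_matrix n h) k"
proof -
  have "bp_recovers_all_sparse n k h \<longleftrightarrow>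
    (\<forall>x \<in> carrier_vec (n * n). card {j. j < n * n \<and> x $ j \<noteq> 0} = k \<longrightarrow>
       bp_solutions (tf_matrix n h) (tf_matrix n h *\<^sub>v x) = {x})"
    unfolding bp_recovers_all_sparse_def has_sparse_rep_def bp_recovers_def
  proof (intro iffI ballI impI)
    fix x :: "complex vec" assume *: "\<forall>\<Gamma>\<in>carrier_mat n n.
        (\<exists>x\<in>carrier_vec (n * n). card {j. j < n * n \<and> x $ j \<noteq> 0} = k \<and> \<Gamma> = tf_synth n x) \<longrightarrow>
        bp_solutions (tf_matrix n h) (\<Gamma> *\<^sub>v h) = {tf_coeffs n \<Gamma>}"
      and x: "x \<in> carrier_vec (n * n)" "card {j. j < n * n \<and> x $ j \<noteq> 0} = k"
    have "tf_synth n x \<in> carrier_mat n n" by (simp add: tf_synth_def)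
    with * x have "bp_solutions (tf_matrix n h) (tf_synth n x *\<^sub>v h) = {tf_coeffs n (tf_synth n x)}"
      by blast
    then show "bp_solutions (tf_matrix n h) (tf_matrix n h *\<^sub>v x) = {x}"
      using x assms by (simp add: tf_coeffs_tf_synth tf_matrix_mult)
  qed (use assms in \<open>auto simp: tf_coeffs_tf_synth tf_matrix_mult\<close>)
  also have "\<dots> \<longleftrightarrow> null_space_property (tf_matrix n h) k"
    using null_space_property_recovery[of "tf_matrix n h" k]
      recovery_null_space_property[of "tf_matrix n h" k] by auto
  finally show ?thesis .
qed

text \<open>Pairing \<open>A *\<^sub>v v = 0\<close> with column \<open>j\<close> writes
  \<open>v $ j\<close> as a combination of the other entries, with coefficients of modulus below
  \<open>1 / (2 k - 1)\<close>. So no entry of a kernel vector reaches the fraction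
  \<open>1 / (2 k)\<close> of its norm, and \<open>k\<close> entries together stay below one
  half.\<close>

lemma coherence_null_space_property:
  fixes A :: "complex mat"
  assumes k: "0 < k"
    and unit: "\<And>j. j < dim_col A \<Longrightarrow> (\<Sum>q<dim_row A. A $$ (q, j) * cnj (A $$ (q, j))) = 1"
    and coh: "\<And>i j. i < dim_col A \<Longrightarrow> j < dim_col A \<Longrightarrow> i \<noteq> j \<Longrightarrow>
      (2 * real k - 1) * cmod (\<Sum>q<dim_row A. A $$ (q, i) * cnj (A $$ (q, j))) < 1"
  shows "null_space_property A k"
  unfolding null_space_property_def
proof (intro ballI allI impI)
  fix v S assume v: "v \<in> carrier_vec (dim_col A)" and S: "S \<subseteq> {..<dim_col A}"
    and ker: "A *\<^sub>v v = 0\<^sub>v (dim_row A)" and v0: "v \<noteq> 0\<^sub>v (dim_col A)" and card: "card S = k"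
  define N where "N = dim_col A"
  define G where "G i j = (\<Sum>q<dim_row A. A $$ (q, i) * cnj (A $$ (q, j)))" for i j
  have main: "2 * real k * cmod (v $ j) < l1_norm v" if j: "j < N" for j
  proof -
    have row: "(\<Sum>i<N. A $$ (q, i) * v $ i) = 0" if "q < dim_row A" for q
    proof -
      have "(A *\<^sub>v v) $ q = (\<Sum>i<N. A $$ (q, i) * v $ i)"
        using that v by (auto simp: N_def scalar_prod_def atLeast0LessThan)
      then show ?thesis using that ker by simp
    qed
    have "(\<Sum>i<N. v $ i * G i j) = (\<Sum>q<dim_row A. (\<Sum>i<N. A $$ (q, i) * v $ i) * cnj (A $$ (q, j)))"
      unfolding G_def sum_distrib_left sum_distrib_right
      by (subst sum.swap) (intro sum.cong refl, simp add: mult_ac)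
    also have "\<dots> = 0" by (intro sum.neutral) (auto simp: row)
    finally have "v $ j * G j j + (\<Sum>i\<in>{..<N} - {j}. v $ i * G i j) = 0"
      using j by (simp add: sum.remove[of "{..<N}" j])
    moreover have "G j j = 1" using unit j by (simp add: G_def N_def)
    ultimately have vj: "v $ j = - (\<Sum>i\<in>{..<N} - {j}. v $ i * G i j)"
      by (simp add: eq_neg_iff_add_eq_0)
    have l1: "l1_norm v = cmod (v $ j) + (\<Sum>i\<in>{..<N} - {j}. cmod (v $ i))"
      using v j by (simp add: l1_norm_def N_def sum.remove[of "{..<dim_col A}" j])
    have less1: "(2 * real k - 1) * cmod (G i j) < 1" if "i < N" "i \<noteq> j" for i
      using coh[of i j] that j by (simp add: G_def N_def)
    \<comment> \<open>A second non-zero entry makes the estimate below strict. If there were none,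
      \<open>vj\<close> would force \<open>v $ j = 0\<close> as well, hence
      \<open>v = 0\<close>.\<close>
    obtain i where i: "i < N" "i \<noteq> j" "v $ i \<noteq> 0"
    proof (rule ccontr)
      assume "\<not> thesis"
      with that have z: "v $ i = 0" if "i < N" "i \<noteq> j" for i using that by auto
      then have "v $ j = 0" using vj by simp
      with z have "v = 0\<^sub>v (dim_col A)" using v by (intro eq_vecI) (auto simp: N_def)
      with v0 show False by simp
    qed
    have "(2 * real k - 1) * cmod (v $ j) \<le>
        (2 * real k - 1) * (\<Sum>i\<in>{..<N} - {j}. cmod (v $ i) * cmod (G i j))"
      using k unfolding vj norm_minus_cancel
      by (intro mult_left_mono sum_norm_le) (auto simp: norm_mult)
    also have "\<dots> = (\<Sum>i\<in>{..<N} - {j}. cmod (v $ i) * ((2 * real k - 1) * cmod (G i j)))"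
      by (simp add: sum_distrib_left mult_ac)
    also have "\<dots> < (\<Sum>i\<in>{..<N} - {j}. cmod (v $ i) * 1)"
    proof (rule sum_strict_mono_ex1)
      show "\<forall>i\<in>{..<N} - {j}. cmod (v $ i) * ((2 * real k - 1) * cmod (G i j)) \<le> cmod (v $ i) * 1"
        using less1[THEN less_imp_le] by (intro ballI mult_left_mono) auto
      show "\<exists>i\<in>{..<N} - {j}. cmod (v $ i) * ((2 * real k - 1) * cmod (G i j)) < cmod (v $ i) * 1"
        using less1[OF i(1,2)] i by (intro bexI[of _ i] mult_strict_left_mono) auto
    qed simp
    finally show ?thesis using l1 by (simp add: algebra_simps)
  qed
  have "real k * (2 * (\<Sum>j\<in>S. cmod (v $ j))) = (\<Sum>j\<in>S. 2 * real k * cmod (v $ j))"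
    by (simp add: sum_distrib_left mult_ac)
  also have "\<dots> < (\<Sum>j\<in>S. l1_norm v)"
    using main S k card by (intro sum_strict_mono) (auto simp: N_def finite_subset)
  also have "\<dots> = real k * l1_norm v" using card by simp
  finally show "2 * (\<Sum>j\<in>S. cmod (v $ j)) < l1_norm v"
    using k by simp
qed

section \<open>Ambiguity function and coherence\<close>

definition unit_char :: "nat \<Rightarrow> int \<Rightarrow> complex" where
  "unit_char n x = cis (2 * pi * of_int x / of_nat n)"

lemma unit_char_add: "unit_char n (x + y) = unit_char n x * unit_char n y"
  by (simp add: unit_char_def cis_mult add_divide_distrib distrib_left)

lemma unit_char_0 [simp]: "unit_char n 0 = 1"
  by (simp add: unit_char_def)

lemma norm_unit_char [simp]: "cmod (unit_char n x) = 1"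
  by (simp add: unit_char_def)

lemma unit_char_minus: "unit_char n (- x) = cnj (unit_char n x)"
  by (simp add: unit_char_def cis_cnj)

lemma unit_char_mult_cnj [simp]: "unit_char n x * cnj (unit_char n x) = 1"
  by (simp add: complex_norm_square[symmetric])

lemma unit_char_period [simp]:
  assumes "0 < n" shows "unit_char n (int n * m) = 1"
proof -
  have "2 * pi * of_int (int n * m) / real n = 2 * pi * of_int m" using assms by simp
  then show ?thesis unfolding unit_char_def by simp
qed

lemma unit_char_cong:
  assumes "[x = y] (mod int n)"
  shows "unit_char n x = unit_char n y"
proof (cases "n = 0")
  case True
  then show ?thesis by (simp add: unit_char_def)
next
  case False
  from assms obtain m where "x = y + int n * m"
    by (metis cong_iff_lin cong_sym)
  with False show ?thesis by (simp add: unit_char_add)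
qed

lemma unit_char_exp:
  "exp (2 * of_real pi * \<i> * of_nat l * of_nat q / of_nat n) = unit_char n (int l * int q)"
  by (simp add: unit_char_def cis_conv_exp mult_ac)

text \<open>The map \<open>f\<close> sending \<open>q\<close> to the residue of \<open>q + a\<close>
  permutes \<open>{..<n}\<close>. All index substitutions in the sums below go through this
  lemma.\<close>

lemma sum_periodic_shift:
  fixes F :: "int \<Rightarrow> 'a::comm_monoid_add"
  assumes per: "\<And>x y. [x = y] (mod int n) \<Longrightarrow> F x = F y"
  shows "(\<Sum>q<n. F (int q + a)) = (\<Sum>q<n. F (int q))"
proof (cases "n = 0")
  case False
  define f where "f q = nat ((int q + a) mod int n)" for q
  have f: "[int (f q) = int q + a] (mod int n)" for q
    using False by (simp add: f_def cong_def)
  have inj: "inj_on f {..<n}"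
  proof (rule inj_onI)
    fix x y assume xy: "x \<in> {..<n}" "y \<in> {..<n}" "f x = f y"
    then have "[int x + a = int y + a] (mod int n)"
      using f[of x] f[of y] by (metis cong_sym cong_trans)
    then have "[int x = int y] (mod int n)" by (simp add: cong_add_rcancel)
    with xy show "x = y" by (simp add: cong_def)
  qed
  moreover have "f ` {..<n} \<subseteq> {..<n}"
    using False by (auto simp: f_def nat_less_iff)
  ultimately have "bij_betw f {..<n} {..<n}"
    by (simp add: bij_betw_def endo_inj_surj)
  then have "(\<Sum>q<n. F (int q)) = (\<Sum>q<n. F (int (f q)))"
    using sum.reindex_bij_betw[of f "{..<n}" "{..<n}" "\<lambda>q. F (int q)"] by simp
  also have "\<dots> = (\<Sum>q<n. F (int q + a))"
    by (intro sum.cong refl per f)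
  finally show ?thesis ..
qed simp

text \<open>Shifting the index by one leaves the sum unchanged but multiplies it by
  \<open>unit_char n a\<close>, which differs from \<open>1\<close>.\<close>

lemma sum_unit_char:
  assumes "0 < n" "\<not> int n dvd a"
  shows "(\<Sum>q<n. unit_char n (a * int q)) = 0"
proof -
  have "(\<Sum>q<n. unit_char n (a * int q)) = (\<Sum>q<n. unit_char n (a * (int q + 1)))"
    by (rule sum_periodic_shift[symmetric])
      (auto intro!: unit_char_cong cong_mult)
  also have "\<dots> = unit_char n a * (\<Sum>q<n. unit_char n (a * int q))"
    by (simp add: distrib_left unit_char_add sum_distrib_left mult.commute)
  finally have "(1 - unit_char n a) * (\<Sum>q<n. unit_char n (a * int q)) = 0"
    by (simp add: algebra_simps)
  moreover have "unit_char n a \<noteq> 1"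
  proof
    assume "unit_char n a = 1"
    then obtain m :: int where "2 * pi * of_int a / real n = 2 * pi * of_int m"
      unfolding unit_char_def cis_conv_exp exp_eq_1 by (auto simp: mult_ac)
    then have "real_of_int a = real_of_int (m * int n)"
      using assms by (simp add: field_simps)
    then have "a = m * int n" by (rule of_int_eq_iff[THEN iffD1])
    with assms show False by simp
  qed
  ultimately show ?thesis by simp
qed

section \<open>Gram matrix of the time-frequency shifts of a window\<close>

definition periodize :: "nat \<Rightarrow> complex vec \<Rightarrow> int \<Rightarrow> complex" where
  "periodize n h x = h $ nat (x mod int n)"

lemma periodize_cong: "[x = y] (mod int n) \<Longrightarrow> periodize n h x = periodize n h y"
  by (simp add: periodize_def cong_def)

text \<open>The discrete ambiguity function. \<open>H\<close> is meant to be periodic modulo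
  \<open>n\<close>, as \<open>periodize n h\<close> is; integer arguments admit negative
  shifts.\<close>

definition ambiguity :: "nat \<Rightarrow> (int \<Rightarrow> complex) \<Rightarrow> int \<Rightarrow> int \<Rightarrow> complex" where
  "ambiguity n H l p = (\<Sum>q<n. unit_char n (l * int q) * (H (int q + p) * cnj (H (int q))))"

lemma tf_matrix_index:
  assumes h: "h \<in> carrier_vec n" and q: "q < n" and j: "j < n * n"
  shows "tf_matrix n h $$ (q, j) =
    unit_char n (int (j div n) * int q) * periodize n h (int q + int (j mod n))"
proof -
  have T: "trans_op n p *\<^sub>v h \<in> carrier_vec n" for p
    by (rule carrier_vecI) (simp add: trans_op_def)
  have "tf_matrix n h $$ (q, j) = (tf_shift n (j div n) (j mod n) *\<^sub>v h) $ q"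
    using q j by (simp add: tf_matrix_def mat_of_cols_def)
  also have "tf_shift n (j div n) (j mod n) *\<^sub>v h
      = mod_op n (j div n) *\<^sub>v (trans_op n (j mod n) *\<^sub>v h)"
    unfolding tf_shift_def using h
    by (intro assoc_mult_mat_vec[of _ n n _ n]) (auto simp: mod_op_def trans_op_def)
  also have "\<dots> $ q = unit_char n (int (j div n) * int q) * h $ ((j mod n + q) mod n)"
    by (simp only: mod_op_apply[OF T q] trans_op_apply[OF h q] unit_char_exp)
  also have "(j mod n + q) mod n = nat ((int q + int (j mod n)) mod int n)"
    by (metis add.commute nat_int of_nat_add of_nat_mod)
  finally show ?thesis unfolding periodize_def .
qed

text \<open>Moving the summation index by the translation of column \<open>j\<close> leaves only the
  difference of the two shifts, up to a phase. The phase has modulus one and does not affect the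
  coherence.\<close>

lemma tf_matrix_gram:
  assumes h: "h \<in> carrier_vec n" and i: "i < n * n" and j: "j < n * n"
  shows "(\<Sum>q<n. tf_matrix n h $$ (q, i) * cnj (tf_matrix n h $$ (q, j))) =
    unit_char n (- (int (i div n) - int (j div n)) * int (j mod n)) *
    ambiguity n (periodize n h) (int (i div n) - int (j div n)) (int (i mod n) - int (j mod n))"
proof -
  define H where "H = periodize n h"
  define l where "l = int (i div n) - int (j div n)"
  define b where "b = int (j mod n)"
  define a where "a = int (i mod n)"
  define F where "F x = unit_char n (l * (x - b)) * (H (x + (a - b)) * cnj (H x))" for x
  have per: "F x = F y" if "[x = y] (mod int n)" for x y
    unfolding F_def H_def using that
    by (intro arg_cong2[of _ _ _ _ "(*)"] unit_char_cong arg_cong[of _ _ cnj] periodize_cong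
        cong_mult cong_add cong_diff cong_refl)
  have "(\<Sum>q<n. tf_matrix n h $$ (q, i) * cnj (tf_matrix n h $$ (q, j))) = (\<Sum>q<n. F (int q + b))"
  proof (intro sum.cong refl)
    fix q assume "q \<in> {..<n}"
    then have q: "q < n" by simp
    have "unit_char n (l * int q) =
        unit_char n (int (i div n) * int q) * cnj (unit_char n (int (j div n) * int q))"
      unfolding unit_char_minus[symmetric] unit_char_add[symmetric] l_def by (simp add: algebra_simps)
    then show "tf_matrix n h $$ (q, i) * cnj (tf_matrix n h $$ (q, j)) = F (int q + b)"
      unfolding tf_matrix_index[OF h q i] tf_matrix_index[OF h q j] F_def H_def a_def b_def
      by (simp add: mult_ac)
  qed
  also have "\<dots> = (\<Sum>q<n. F (int q))"
    by (rule sum_periodic_shift[of n F, OF per])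
  also have "\<dots> = unit_char n (- l * b) * ambiguity n H l (a - b)"
    unfolding ambiguity_def sum_distrib_left
  proof (intro sum.cong refl)
    fix q
    have "l * (int q - b) = - l * b + l * int q" by (simp add: algebra_simps)
    then show "F (int q) =
        unit_char n (- l * b) * (unit_char n (l * int q) * (H (int q + (a - b)) * cnj (H (int q))))"
      unfolding F_def by (simp only: unit_char_add mult.assoc)
  qed
  finally show ?thesis by (simp only: H_def l_def a_def b_def)
qed

lemma ambiguity_cong:
  assumes H: "\<And>x y. [x = y] (mod int n) \<Longrightarrow> H x = H y"
    and "[l = l'] (mod int n)" "[p = p'] (mod int n)"
  shows "ambiguity n H l p = ambiguity n H l' p'"
  unfolding ambiguity_def using assms
  by (intro sum.cong refl arg_cong2[of _ _ _ _ "(*)"] unit_char_cong H cong_mult cong_add cong_refl)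

text \<open>The substitution \<open>q + p\<close> for \<open>q\<close> turns one sum into the
  conjugate of the other, up to a phase.\<close>

lemma norm_ambiguity_minus:
  assumes H: "\<And>x y. [x = y] (mod int n) \<Longrightarrow> H x = H y"
  shows "cmod (ambiguity n H (- l) (- p)) = cmod (ambiguity n H l p)"
proof -
  define F where "F x = unit_char n (- l * x) * (H (x - p) * cnj (H x))" for x
  have per: "F x = F y" if "[x = y] (mod int n)" for x y
    unfolding F_def using that
    by (intro arg_cong2[of _ _ _ _ "(*)"] unit_char_cong arg_cong[of _ _ cnj] H
        cong_mult cong_diff cong_refl)
  have "ambiguity n H (- l) (- p) = (\<Sum>q<n. F (int q))"
    by (simp add: ambiguity_def F_def)
  also have "\<dots> = (\<Sum>q<n. F (int q + p))"
    by (rule sum_periodic_shift[of n F, OF per, symmetric])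
  also have "\<dots> = unit_char n (- l * p) * cnj (ambiguity n H l p)"
    unfolding ambiguity_def cnj_sum sum_distrib_left
  proof (intro sum.cong refl)
    fix q
    have "- l * (int q + p) = - l * p + - (l * int q)" by (simp add: algebra_simps)
    then show "F (int q + p) = unit_char n (- l * p) *
        cnj (unit_char n (l * int q) * (H (int q + p) * cnj (H (int q))))"
      unfolding F_def by (simp only: unit_char_add unit_char_minus) (simp add: mult_ac)
  qed
  finally show ?thesis by (simp add: norm_mult)
qed

text \<open>For a window of constant modulus this is a multiple of a nontrivial character
  sum.\<close>

lemma ambiguity_untranslated:
  assumes "0 < n" "\<not> int n dvd l" "\<And>x. H x * cnj (H x) = c"
  shows "ambiguity n H l 0 = 0"
  using assms sum_unit_char[of n l] by (simp add: ambiguity_def sum_distrib_right[symmetric])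

text \<open>Pure modulations are orthogonal since the window has constant modulus, and reflection
  replaces \<open>p\<close> by \<open>n - p\<close>. Hence a bound for translations up to
  \<open>n / 2\<close> suffices, which is the range in which the half sums of the random window have
  no cycles.\<close>

lemma ambiguity_recovery:
  assumes h: "h \<in> carrier_vec n" and n: "0 < n" and k: "0 < k"
    and unim: "\<And>q. q < n \<Longrightarrow> h $ q * cnj (h $ q) = 1 / of_nat n"
    and bound: "\<And>l p. l < n \<Longrightarrow> 0 < p \<Longrightarrow> 2 * p \<le> n \<Longrightarrow>
      (2 * real k - 1) * cmod (ambiguity n (periodize n h) (int l) (int p)) < 1"
  shows "bp_recovers_all_sparse n k h"
proof -
  define H where "H = periodize n h"
  have Hcong: "H x = H y" if "[x = y] (mod int n)" for x y
    unfolding H_def by (rule periodize_cong[OF that])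
  have Hunim: "H x * cnj (H x) = 1 / of_nat n" for x
    unfolding H_def periodize_def using n by (intro unim) (simp add: nat_less_iff)
  have amb: "(2 * real k - 1) * cmod (ambiguity n H l p) < 1"
    if lp: "\<not> (int n dvd l \<and> int n dvd p)" for l p
  proof (cases "int n dvd p")
    case True
    then have "ambiguity n H l p = ambiguity n H l 0"
      by (intro ambiguity_cong Hcong) (auto simp: cong_0_iff)
    also have "\<dots> = 0"
      using lp True n by (intro ambiguity_untranslated[OF _ _ Hunim]) auto
    finally show ?thesis by simp
  next
    case False
    have small: "(2 * real k - 1) * cmod (ambiguity n H l p) < 1"
      if p: "\<not> int n dvd p" "2 * (p mod int n) \<le> int n" for l p
    proof -
      have "0 < p mod int n"
        using p n by (metis dvd_eq_mod_eq_0 of_nat_0_less_iff pos_mod_sign order_le_less)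
      then have "(2 * real k - 1) *
          cmod (ambiguity n H (int (nat (l mod int n))) (int (nat (p mod int n)))) < 1"
        unfolding H_def using p n by (intro bound) (auto simp: nat_less_iff)
      also have "ambiguity n H (int (nat (l mod int n))) (int (nat (p mod int n))) = ambiguity n H l p"
        using n by (intro ambiguity_cong Hcong) auto
      finally show ?thesis .
    qed
    show ?thesis
    proof (cases "2 * (p mod int n) \<le> int n")
      case True
      with False show ?thesis by (rule small)
    next
      case big: False
      \<comment> \<open>A residue above \<open>n / 2\<close> is reflected to one below
        \<open>n / 2\<close>, where \<open>small\<close> applies.\<close>
      have "(- p) mod int n = int n - p mod int n"
        using False n by (simp add: zmod_zminus1_eq_if dvd_eq_mod_eq_0)
      then have "(2 * real k - 1) * cmod (ambiguity n H (- l) (- p)) < 1"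
        using False big by (intro small) auto
      then show ?thesis by (simp add: norm_ambiguity_minus[OF Hcong])
    qed
  qed
  have "null_space_property (tf_matrix n h) k"
  proof (rule coherence_null_space_property[OF k], unfold dim_tf_matrix)
    fix j assume "j < n * n"
    then show "(\<Sum>q<n. tf_matrix n h $$ (q, j) * cnj (tf_matrix n h $$ (q, j))) = 1"
      using n by (simp add: tf_matrix_gram[OF h] ambiguity_def Hunim[unfolded H_def])
  next
    fix i j assume ij: "i < n * n" "j < n * n" "i \<noteq> j"
    have "\<not> (int n dvd int (i div n) - int (j div n) \<and> int n dvd int (i mod n) - int (j mod n))"
    proof
      assume "int n dvd int (i div n) - int (j div n) \<and> int n dvd int (i mod n) - int (j mod n)"
      then have "[i div n = j div n] (mod n)" "[i mod n = j mod n] (mod n)"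
        by (simp_all add: cong_iff_dvd_diff flip: cong_int_iff)
      moreover have "i div n < n" "j div n < n"
        using ij by (auto simp: less_mult_imp_div_less)
      ultimately have "i div n = j div n" "i mod n = j mod n"
        by (auto simp: cong_def)
      then have "i = j" by (metis div_mult_mod_eq)
      with ij show False by simp
    qed
    from amb[OF this] show "(2 * real k - 1) *
        cmod (\<Sum>q<n. tf_matrix n h $$ (q, i) * cnj (tf_matrix n h $$ (q, j))) < 1"
      using ij by (simp add: tf_matrix_gram[OF h] norm_mult H_def)
  qed
  then show ?thesis using h by (simp add: bp_recovers_all_sparse_iff)
qed

section \<open>Alltop window\<close>

text \<open>In the squared modulus, shifting \<open>q\<close> by \<open>r\<close> cancels the part
  depending on \<open>r\<close> alone and leaves the character \<open>2 * a * q * r\<close>. Summed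
  over \<open>r\<close> it vanishes unless \<open>q = 0\<close>, because \<open>2 * a\<close> is
  invertible modulo \<open>n\<close>.\<close>

lemma norm_quadratic_gauss_sum:
  assumes n: "0 < n" and a: "coprime (2 * a) (int n)"
  shows "cmod (\<Sum>q<n. unit_char n (a * int q ^ 2 + b * int q)) = sqrt n"
proof -
  define f where "f x = unit_char n (a * x ^ 2 + b * x)" for x
  define G where "G = (\<Sum>q<n. f (int q))"
  have f_cong: "f x = f y" if "[x = y] (mod int n)" for x y
    unfolding f_def using that
    by (intro unit_char_cong cong_add cong_mult cong_pow cong_refl)
  have row: "(\<Sum>q<n. f (int q) * cnj (f (int r))) = (\<Sum>q<n. f (int q) * unit_char n (2 * a * int q * int r))"
    for r
  proof -
    have "(\<Sum>q<n. f (int q) * cnj (f (int r))) = (\<Sum>q<n. f (int q + int r) * cnj (f (int r)))"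
      by (rule sum_periodic_shift[of n "\<lambda>x. f x * cnj (f (int r))", symmetric])
        (auto dest: f_cong)
    also have "\<dots> = (\<Sum>q<n. f (int q) * unit_char n (2 * a * int q * int r))"
      unfolding f_def unit_char_minus[symmetric] unit_char_add[symmetric]
      by (simp add: power2_eq_square algebra_simps)
    finally show ?thesis .
  qed
  have "G * cnj G = (\<Sum>r<n. \<Sum>q<n. f (int q) * cnj (f (int r)))"
    unfolding G_def cnj_sum sum_distrib_left sum_distrib_right by (rule refl)
  also have "\<dots> = (\<Sum>r<n. \<Sum>q<n. f (int q) * unit_char n (2 * a * int q * int r))"
    by (simp add: row)
  also have "\<dots> = (\<Sum>q<n. f (int q) * (\<Sum>r<n. unit_char n (2 * a * int q * int r)))"
    by (subst sum.swap) (simp add: sum_distrib_left)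
  also have "\<dots> = (\<Sum>q<n. if q = 0 then of_nat n else 0)"
  proof (intro sum.cong refl)
    fix q assume q: "q \<in> {..<n}"
    show "f (int q) * (\<Sum>r<n. unit_char n (2 * a * int q * int r)) = (if q = 0 then of_nat n else 0)"
    proof (cases "q = 0")
      case False
      have "\<not> int n dvd 2 * a * int q"
      proof
        assume "int n dvd 2 * a * int q"
        then have "int n dvd int q"
          using a by (simp add: coprime_dvd_mult_right_iff coprime_commute)
        with False q show False by (auto dest: zdvd_imp_le)
      qed
      with sum_unit_char[OF n this] False show ?thesis by simp
    qed (simp add: f_def)
  qed
  also have "\<dots> = of_nat n" using n by simp
  finally have "complex_of_real ((cmod G)\<^sup>2) = complex_of_real (real n)"
    using complex_norm_square[of G] by simp
  then have "(cmod G)\<^sup>2 = real n" by (rule of_real_eq_iff[THEN iffD1])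
  then have "cmod G = sqrt n"
    by (metis norm_ge_zero real_sqrt_unique)
  then show ?thesis by (simp add: G_def f_def)
qed

lemma alltop_window_index:
  assumes "q < n"
  shows "alltop_window n $ q = 1 / of_real (sqrt n) * unit_char n (int q ^ 3)"
  using assms by (simp add: alltop_window_def unit_char_def cis_conv_exp mult_ac)

lemma periodize_alltop_window:
  assumes n: "0 < n"
  shows "periodize n (alltop_window n) x = 1 / of_real (sqrt n) * unit_char n (x ^ 3)"
proof -
  have "periodize n (alltop_window n) x
      = 1 / of_real (sqrt n) * unit_char n (int (nat (x mod int n)) ^ 3)"
    unfolding periodize_def using n by (intro alltop_window_index) (simp add: nat_less_iff)
  also have "unit_char n (int (nat (x mod int n)) ^ 3) = unit_char n (x ^ 3)"
    using n by (intro unit_char_cong cong_pow) simp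
  finally show ?thesis .
qed

text \<open>The difference of the cubes of \<open>q + p\<close> and \<open>q\<close> is quadratic in
  \<open>q\<close> with leading coefficient \<open>3 * p\<close>, so the ambiguity function is a
  Gauss sum divided by \<open>n\<close>.\<close>

lemma alltop_recovery:
  assumes n: "prime n" "5 \<le> n" and k: "0 < k" "real k < (sqrt n + 1) / 2"
  shows "bp_recovers_all_sparse n k (alltop_window n)"
proof (rule ambiguity_recovery)
  let ?H = "periodize n (alltop_window n)"
  have n0: "0 < n" using n by simp
  have sq: "complex_of_real (sqrt n) * complex_of_real (sqrt n) = of_nat n"
    by (simp flip: of_real_mult)
  show "alltop_window n \<in> carrier_vec n" "0 < n" "0 < k"
    using n k by (auto simp: alltop_window_def)
  show "alltop_window n $ q * cnj (alltop_window n $ q) = 1 / of_nat n" if "q < n" for q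
    using that by (simp add: alltop_window_index sq)
  fix l p assume p: "0 < p" "2 * p \<le> n"
  \<comment> \<open>Here \<open>5 \<le> n\<close> rules out the primes 2 and 3, and
    \<open>2 * p \<le> n\<close> keeps \<open>p\<close> below \<open>n\<close>.\<close>
  have coprime: "coprime (2 * (3 * int p)) (int n)"
  proof -
    have "\<not> n dvd 2" "\<not> n dvd 3" "\<not> n dvd p"
      using n p by (auto dest: dvd_imp_le)
    then have "\<not> n dvd 2 * (3 * p)"
      unfolding prime_dvd_mult_iff[OF n(1)] by simp
    then have "coprime (2 * (3 * p)) n"
      using n by (metis coprime_commute prime_imp_coprime)
    then show ?thesis
      by (simp flip: coprime_int_iff)
  qed
  have "ambiguity n ?H (int l) (int p) = (\<Sum>q<n. unit_char n (int p ^ 3) / of_nat n *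
      unit_char n (3 * int p * int q ^ 2 + (3 * int p ^ 2 + int l) * int q))"
    unfolding ambiguity_def
  proof (intro sum.cong refl)
    fix q
    have "unit_char n (int l * int q) * (?H (int q + int p) * cnj (?H (int q))) =
        unit_char n (int l * int q + ((int q + int p) ^ 3 + - (int q ^ 3))) / of_nat n"
      unfolding periodize_alltop_window[OF n0] unit_char_add unit_char_minus by (simp add: sq)
    also have "int l * int q + ((int q + int p) ^ 3 + - (int q ^ 3)) =
        int p ^ 3 + (3 * int p * int q ^ 2 + (3 * int p ^ 2 + int l) * int q)"
      by (simp add: power2_eq_square power3_eq_cube algebra_simps)
    finally show "unit_char n (int l * int q) * (?H (int q + int p) * cnj (?H (int q))) =
        unit_char n (int p ^ 3) / of_nat n *
        unit_char n (3 * int p * int q ^ 2 + (3 * int p ^ 2 + int l) * int q)"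
      by (simp add: unit_char_add)
  qed
  then have "cmod (ambiguity n ?H (int l) (int p)) = sqrt n / n"
    by (simp only: norm_mult norm_divide norm_of_nat norm_unit_char
        norm_quadratic_gauss_sum[OF n0 coprime] flip: sum_distrib_left) simp
  also have "\<dots> = 1 / sqrt n" using n0 by (simp add: field_simps)
  finally have "cmod (ambiguity n ?H (int l) (int p)) = 1 / sqrt n" .
  \<comment> \<open>The assumption on \<open>k\<close> says exactly that \<open>2 k - 1\<close> is
    less than \<open>sqrt n\<close>.\<close>
  moreover have "(2 * real k - 1) / sqrt n < 1" using k n0 by simp
  ultimately show "(2 * real k - 1) * cmod (ambiguity n ?H (int l) (int p)) < 1" by simp
qed

section \<open>Measurability of the recovery event\<close>

text \<open>The unit sphere of the l1 norm, with vectors coded as functions that vanish from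
  \<open>N\<close> on. In the product topology it is a closed subset of a product of discs and
  singletons, which is compact by Tychonoff.\<close>

lemma compact_simplex_vectors:
  "compact {v :: nat \<Rightarrow> complex. (\<forall>j\<ge>N. v j = 0) \<and> (\<Sum>j<N. cmod (v j)) = 1}"
proof -
  let ?B = "\<lambda>j. if j < N then cball 0 1 else {0 :: complex}"
  have "compactin (product_topology (\<lambda>_. euclidean) UNIV) (Pi\<^sub>E UNIV ?B)"
    unfolding compactin_PiE by simp
  then have "compact (Pi\<^sub>E UNIV ?B)"
    by (simp add: euclidean_product_topology)
  moreover have "closed {v :: nat \<Rightarrow> complex. (\<Sum>j<N. cmod (v j)) = 1}"
    by (intro closed_Collect_eq continuous_intros continuous_on_product_coordinates)
  ultimately have "compact (Pi\<^sub>E UNIV ?B \<inter> {v. (\<Sum>j<N. cmod (v j)) = 1})"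
    by (rule compact_Int_closed)
  also have "Pi\<^sub>E UNIV ?B \<inter> {v. (\<Sum>j<N. cmod (v j)) = 1}
      = {v. (\<forall>j\<ge>N. v j = 0) \<and> (\<Sum>j<N. cmod (v j)) = 1}"
  proof (intro equalityI subsetI)
    fix v :: "nat \<Rightarrow> complex" assume "v \<in> {v. (\<forall>j\<ge>N. v j = 0) \<and> (\<Sum>j<N. cmod (v j)) = 1}"
    then have v: "\<forall>j\<ge>N. v j = 0" and s: "(\<Sum>j<N. cmod (v j)) = 1" by auto
    have "cmod (v j) \<le> 1" if "j < N" for j
      using that member_le_sum[of j "{..<N}" "\<lambda>j. cmod (v j)"] s by simp
    with v s show "v \<in> Pi\<^sub>E UNIV ?B \<inter> {v. (\<Sum>j<N. cmod (v j)) = 1}"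
      by (auto simp: PiE_iff)
  next
    fix v assume v: "v \<in> Pi\<^sub>E UNIV ?B \<inter> {v. (\<Sum>j<N. cmod (v j)) = 1}"
    then have "v j \<in> ?B j" for j by blast
    then have "v j = 0" if "j \<ge> N" for j using that by (metis not_less singletonD)
    with v show "v \<in> {v. (\<forall>j\<ge>N. v j = 0) \<and> (\<Sum>j<N. cmod (v j)) = 1}" by auto
  qed
  finally show ?thesis .
qed

text \<open>The property is homogeneous in the kernel vector, so it need only be tested on the
  compact sphere \<open>K\<close>. Violating pairs form a closed set, and by the tube lemma the
  parameters with no violation on \<open>K\<close> form an open set. Finitely many \<open>S\<close>
  remain to be intersected.\<close>

lemma open_null_space_property:
  fixes A :: "'a::topological_space \<Rightarrow> complex mat"
  assumes A: "\<And>w. A w \<in> carrier_mat m N"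
    and cont: "\<And>q j. q < m \<Longrightarrow> j < N \<Longrightarrow> continuous_on UNIV (\<lambda>w. A w $$ (q, j))"
  shows "open {w. null_space_property (A w) k}"
proof -
  define K where "K = {v :: nat \<Rightarrow> complex. (\<forall>j\<ge>N. v j = 0) \<and> (\<Sum>j<N. cmod (v j)) = 1}"
  define W where "W S = - {(w, v). (\<forall>q<m. (\<Sum>j<N. A w $$ (q, j) * v j) = 0) \<and>
      (\<Sum>j<N. cmod (v j)) \<le> 2 * (\<Sum>j\<in>S. cmod (v j))}" for S
  define U where "U S = {w. {w} \<times> K \<subseteq> W S}" for S
  have open_W: "open (W S)" if S: "S \<subseteq> {..<N}" for S
  proof -
    have c: "continuous_on UNIV (\<lambda>x. A (fst x) $$ (q, j))" if "q < m" "j < N" for q j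
      using continuous_on_compose2[OF cont[OF that], of UNIV fst] by (simp add: continuous_on_fst)
    have e: "continuous_on UNIV (\<lambda>x::'a \<times> (nat \<Rightarrow> complex). snd x j)" for j
      using continuous_on_compose2[OF continuous_on_product_coordinates[of j], of UNIV snd]
      by (simp add: continuous_on_snd)
    have eq: "W S = - ((\<Inter>q\<in>{..<m}. {x. (\<Sum>j<N. A (fst x) $$ (q, j) * snd x j) = 0}) \<inter>
        {x. (\<Sum>j<N. cmod (snd x j)) \<le> 2 * (\<Sum>j\<in>S. cmod (snd x j))})"
      by (auto simp: W_def)
    show ?thesis
      unfolding eq using S
      by (intro open_Compl closed_Int closed_INT ballI closed_Collect_eq closed_Collect_le
          continuous_intros c e) auto
  qed
  have open_U: "open (U S)" if "S \<subseteq> {..<N}" for S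
  proof (subst open_subopen, intro ballI)
    fix w assume "w \<in> U S"
    then have "{w} \<times> K \<subseteq> W S" by (simp add: U_def)
    from Elementary_Topology.tube_lemma[OF compact_simplex_vectors[of N, folded K_def] open_W[OF that] this]
    show "\<exists>T. open T \<and> w \<in> T \<and> T \<subseteq> U S"
      unfolding U_def by blast
  qed
  have "{w. null_space_property (A w) k} = (\<Inter>S\<in>{S. S \<subseteq> {..<N} \<and> card S = k}. U S)"
  proof (intro equalityI subsetI)
    fix w assume w: "w \<in> {w. null_space_property (A w) k}"
    show "w \<in> (\<Inter>S\<in>{S. S \<subseteq> {..<N} \<and> card S = k}. U S)"
      unfolding U_def
    proof (intro INT_I CollectI subsetI)
      fix S x assume S: "S \<in> {S. S \<subseteq> {..<N} \<and> card S = k}" and "x \<in> {w} \<times> K"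
      then obtain v where x: "x = (w, v)" and v: "v \<in> K" by blast
      show "x \<in> W S"
      proof (rule ccontr)
        assume "x \<notin> W S"
        then have ker: "\<forall>q<m. (\<Sum>j<N. A w $$ (q, j) * v j) = 0"
          and le: "(\<Sum>j<N. cmod (v j)) \<le> 2 * (\<Sum>j\<in>S. cmod (v j))"
          by (auto simp: W_def x)
        have "A w *\<^sub>v vec N v = 0\<^sub>v (dim_row (A w))"
          using A[of w] ker by (intro eq_vecI) (auto simp: scalar_prod_def atLeast0LessThan)
        moreover have "vec N v \<noteq> 0\<^sub>v N"
        proof
          assume "vec N v = 0\<^sub>v N"
          then have "v j = 0" if "j < N" for j using that by (metis index_vec index_zero_vec(1))
          with v show False by (simp add: K_def)
        qed
        ultimately have "2 * (\<Sum>j\<in>S. cmod (vec N v $ j)) < l1_norm (vec N v)"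
          using w S A[of w] by (auto simp: null_space_property_def)
        also have "l1_norm (vec N v) = (\<Sum>j<N. cmod (v j))" by (simp add: l1_norm_def)
        also have "(\<Sum>j\<in>S. cmod (vec N v $ j)) = (\<Sum>j\<in>S. cmod (v j))"
          using S by (intro sum.cong) auto
        finally show False using le by simp
      qed
    qed
  next
    fix w assume w: "w \<in> (\<Inter>S\<in>{S. S \<subseteq> {..<N} \<and> card S = k}. U S)"
    have "null_space_property (A w) k"
      unfolding null_space_property_def
    proof (intro ballI allI impI)
      fix v S assume v: "v \<in> carrier_vec (dim_col (A w))" and S: "S \<subseteq> {..<dim_col (A w)}"
        and ker: "A w *\<^sub>v v = 0\<^sub>v (dim_row (A w))" and v0: "v \<noteq> 0\<^sub>v (dim_col (A w))"
        and card: "card S = k"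
      define c where "c = l1_norm v"
      have vN: "dim_vec v = N" and SN: "S \<subseteq> {..<N}" using v S A[of w] by auto
      have c: "c = (\<Sum>j<N. cmod (v $ j))" by (simp add: c_def l1_norm_def vN)
      have "0 < c"
      proof -
        obtain j where "j < N" "v $ j \<noteq> 0"
          using v0 v A[of w] by (metis carrier_matD(2) carrier_vecD eq_vecI index_zero_vec)
        then show ?thesis unfolding c by (intro sum_pos2[of _ j]) auto
      qed
      \<comment> \<open>The kernel vector scaled to norm one and extended by zeros, so that it lies
        in \<open>K\<close>.\<close>
      define u where "u j = (if j < N then v $ j / of_real c else 0)" for j
      have cu: "cmod (u j) = cmod (v $ j) / c" if "j < N" for j
        using that \<open>0 < c\<close> by (simp add: u_def norm_divide)
      have "u \<in> K"
        using \<open>0 < c\<close> by (simp add: K_def cu sum_divide_distrib[symmetric] flip: c) (simp add: u_def)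
      moreover have "(\<Sum>j<N. A w $$ (q, j) * u j) = 0" if "q < m" for q
      proof -
        have "(\<Sum>j<N. A w $$ (q, j) * u j) = (\<Sum>j<N. A w $$ (q, j) * v $ j) / of_real c"
          by (simp add: u_def sum_divide_distrib)
        also have "(\<Sum>j<N. A w $$ (q, j) * v $ j) = (A w *\<^sub>v v) $ q"
          using that A[of w] vN by (auto simp: scalar_prod_def atLeast0LessThan)
        finally show ?thesis using that A[of w] ker by simp
      qed
      moreover have "(w, u) \<in> W S"
        using w SN card \<open>u \<in> K\<close> by (auto simp: U_def)
      ultimately have "2 * (\<Sum>j\<in>S. cmod (u j)) < (\<Sum>j<N. cmod (u j))"
        by (auto simp: W_def)
      also have "(\<Sum>j\<in>S. cmod (u j)) = (\<Sum>j\<in>S. cmod (v $ j)) / c"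
        unfolding sum_divide_distrib using SN by (intro sum.cong refl cu) auto
      also have "(\<Sum>j<N. cmod (u j)) = c / c"
        by (simp add: cu flip: sum_divide_distrib c)
      finally show "2 * (\<Sum>j\<in>S. cmod (v $ j)) < l1_norm v"
        using \<open>0 < c\<close> by (simp add: field_simps c_def)
    qed
    then show "w \<in> {w. null_space_property (A w) k}" by simp
  qed
  moreover have "finite {S. S \<subseteq> {..<N} \<and> card S = k}" by simp
  ultimately show ?thesis using open_U by (auto intro!: open_INT)
qed

text \<open>The window becomes a measurable map \<open>f\<close> into the space of functions on the
  naturals, with zeros from \<open>n\<close> on. The event is the preimage of an open set.\<close>

lemma recovery_set_measurable:
  assumes n: "0 < n" and \<epsilon>: "\<And>q. q < n \<Longrightarrow> \<epsilon> q \<in> borel_measurable M"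
  shows "{\<omega> \<in> space M. bp_recovers_all_sparse n k (random_window n \<epsilon> \<omega>)} \<in> sets M"
proof -
  define f where "f \<omega> q = (if q < n then 1 / of_real (sqrt n) * \<epsilon> q \<omega> else 0)" for \<omega> q
  have f: "f \<in> borel_measurable M"
    unfolding f_def
  proof (rule measurable_coordinatewise_then_product)
    fix q show "(\<lambda>\<omega>. if q < n then 1 / of_real (sqrt n) * \<epsilon> q \<omega> else 0) \<in> borel_measurable M"
      using \<epsilon> by (cases "q < n") auto
  qed
  have "open {w. null_space_property (tf_matrix n (vec n w)) k}"
  proof (rule open_null_space_property[of _ n "n * n"])
    fix q j assume qj: "q < n" "j < n * n"
    have *: "nat ((int q + int (j mod n)) mod int n) < n" using n by (simp add: nat_less_iff)
    show "continuous_on UNIV (\<lambda>w. tf_matrix n (vec n w) $$ (q, j))"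
      using qj * by (simp add: tf_matrix_index[of "vec n _"] periodize_def)
        (intro continuous_intros continuous_on_product_coordinates)
  qed auto
  then have "f -` {w. null_space_property (tf_matrix n (vec n w)) k} \<inter> space M \<in> sets M"
    using f by (intro measurable_sets) auto
  also have "f -` {w. null_space_property (tf_matrix n (vec n w)) k} \<inter> space M =
      {\<omega> \<in> space M. bp_recovers_all_sparse n k (random_window n \<epsilon> \<omega>)}"
  proof -
    have "random_window n \<epsilon> \<omega> = vec n (f \<omega>)" for \<omega>
      by (auto simp: random_window_def f_def)
    then show ?thesis by (auto simp: bp_recovers_all_sparse_iff)
  qed
  finally show ?thesis .
qed

section \<open>Tail bounds\<close>

text \<open>Scaling by \<open>2 * b\<close> bounds the terms of the exponential series by powers of
  \<open>1 / 2\<close>, so the exponential moment is at most \<open>2\<close>. Markov's inequality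
  then gives the tail.\<close>

lemma (in prob_space) factorial_moments_tail:
  fixes Y :: "'a \<Rightarrow> real"
  assumes [measurable]: "Y \<in> borel_measurable M" and b: "0 < b"
    and Y: "\<And>\<omega>. \<omega> \<in> space M \<Longrightarrow> 0 \<le> Y \<omega> \<and> Y \<omega> \<le> B"
    and moment: "\<And>k. expectation (\<lambda>\<omega>. Y \<omega> ^ k) \<le> fact k * b ^ k"
  shows "prob {\<omega> \<in> space M. 2 * b * L \<le> Y \<omega>} \<le> 2 * exp (- L)"
proof -
  define Z where "Z \<omega> = Y \<omega> / (2 * b)" for \<omega>
  have [measurable]: "Z \<in> borel_measurable M" unfolding Z_def by measurable
  have Z: "0 \<le> Z \<omega>" "Z \<omega> \<le> B / (2 * b)" if "\<omega> \<in> space M" for \<omega>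
    using Y[OF that] b by (auto simp: Z_def divide_right_mono)
  have int: "integrable M (\<lambda>\<omega>. Z \<omega> ^ k)" for k
    using Z by (intro integrable_const_bound[of _ "(B / (2 * b)) ^ k"])
      (auto intro!: power_mono AE_I2)
  have Zk: "expectation (\<lambda>\<omega>. Z \<omega> ^ k) \<le> fact k * (1 / 2) ^ k" for k
  proof -
    have "expectation (\<lambda>\<omega>. Z \<omega> ^ k) = expectation (\<lambda>\<omega>. Y \<omega> ^ k) / (2 * b) ^ k"
      by (simp add: Z_def power_divide)
    also have "\<dots> \<le> fact k * b ^ k / (2 * b) ^ k"
      using b by (intro divide_right_mono moment) auto
    also have "\<dots> = fact k * (1 / 2) ^ k"
      using b by (simp add: power_mult_distrib power_divide)
    finally show ?thesis .
  qed
  have partial: "expectation (\<lambda>\<omega>. \<Sum>k<K. Z \<omega> ^ k / fact k) \<le> 2" for K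
  proof -
    have "expectation (\<lambda>\<omega>. \<Sum>k<K. Z \<omega> ^ k / fact k) = (\<Sum>k<K. expectation (\<lambda>\<omega>. Z \<omega> ^ k) / fact k)"
      using int by simp
    also have "\<dots> \<le> (\<Sum>k<K. (1 / 2) ^ k)"
      using Zk by (intro sum_mono) (simp add: field_simps)
    also have "\<dots> \<le> (\<Sum>k. (1 / 2) ^ k)"
      by (intro sum_le_suminf) auto
    also have "\<dots> = 2" by (subst suminf_geometric) auto
    finally show ?thesis .
  qed
  have exp_sums: "(\<lambda>k. x ^ k / fact k) sums exp x" for x :: real
    using exp_converges[of x] by (simp add: divide_inverse mult.commute)
  have exp_int: "integrable M (\<lambda>\<omega>. exp (Z \<omega>))"
    using Z by (intro integrable_const_bound[of _ "exp (B / (2 * b))"]) (auto intro!: AE_I2)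
  have "expectation (\<lambda>\<omega>. exp (Z \<omega>)) \<le> 2"
  proof (rule LIMSEQ_le_const2)
    show "(\<lambda>K. expectation (\<lambda>\<omega>. \<Sum>k<K. Z \<omega> ^ k / fact k)) \<longlonglongrightarrow> expectation (\<lambda>\<omega>. exp (Z \<omega>))"
    \<comment> \<open>As \<open>Z\<close> is nonnegative, the partial sums stay below their limit,
      which is itself an integrable dominating function.\<close>
    proof (rule integral_dominated_convergence[where w = "\<lambda>\<omega>. exp (Z \<omega>)"])
      show "AE \<omega> in M. (\<lambda>K. \<Sum>k<K. Z \<omega> ^ k / fact k) \<longlonglongrightarrow> exp (Z \<omega>)"
        using exp_sums by (intro AE_I2) (simp add: sums_def)
      show "AE \<omega> in M. norm (\<Sum>k<K. Z \<omega> ^ k / fact k) \<le> exp (Z \<omega>)" for K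
      proof (rule AE_I2)
        fix \<omega> assume \<omega>: "\<omega> \<in> space M"
        then have "(\<Sum>k<K. Z \<omega> ^ k / fact k) \<le> (\<Sum>k. Z \<omega> ^ k / fact k)"
          using exp_sums[of "Z \<omega>"] Z[OF \<omega>] by (intro sum_le_suminf) (auto simp: sums_iff)
        moreover have "0 \<le> (\<Sum>k<K. Z \<omega> ^ k / fact k)"
          using Z[OF \<omega>] by (intro sum_nonneg) auto
        ultimately show "norm (\<Sum>k<K. Z \<omega> ^ k / fact k) \<le> exp (Z \<omega>)"
          using exp_sums[of "Z \<omega>"] by (simp add: sums_iff)
      qed
    qed (use exp_int in auto)
  qed (use partial in auto)
  moreover have "prob {\<omega> \<in> space M. exp L \<le> exp (Z \<omega>)} \<le> expectation (\<lambda>\<omega>. exp (Z \<omega>)) / exp L"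
    by (rule integral_Markov_inequality_measure[OF exp_int, of "{}"]) auto
  moreover have "{\<omega> \<in> space M. exp L \<le> exp (Z \<omega>)} = {\<omega> \<in> space M. 2 * b * L \<le> Y \<omega>}"
    using b by (auto simp: Z_def field_simps)
  ultimately show ?thesis
    by (simp add: exp_minus divide_inverse order_trans mult_right_mono)
qed

section \<open>Moments of chains of independent unimodular variables\<close>

lemma borel_measurable_cnj [measurable]: "cnj \<in> borel_measurable borel"
  by (intro borel_measurable_continuous_onI continuous_intros)

text \<open>Both \<open>(W + S) ^ k\<close> and its conjugate are expanded binomially. By
  \<open>orth\<close> only terms with equal powers of \<open>W\<close> and its conjugate survive,
  and there \<open>W\<close> contributes the factor \<open>1\<close>.\<close>

lemma (in prob_space) moment_add_unimodular:
  fixes S W :: "'a \<Rightarrow> complex"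
  assumes [measurable]: "S \<in> borel_measurable M" "W \<in> borel_measurable M"
    and S: "\<And>\<omega>. \<omega> \<in> space M \<Longrightarrow> cmod (S \<omega>) \<le> B"
    and W: "\<And>\<omega>. \<omega> \<in> space M \<Longrightarrow> cmod (W \<omega>) = 1"
    and orth: "\<And>i j a b. i \<noteq> j \<Longrightarrow>
      expectation (\<lambda>\<omega>. W \<omega> ^ i * cnj (W \<omega>) ^ j * (S \<omega> ^ a * cnj (S \<omega>) ^ b)) = 0"
  shows "expectation (\<lambda>\<omega>. cmod (W \<omega> + S \<omega>) ^ (2 * k)) =
    (\<Sum>i\<le>k. (real (k choose i))\<^sup>2 * expectation (\<lambda>\<omega>. cmod (S \<omega>) ^ (2 * (k - i))))"
proof -
  define T where "T i j \<omega> = W \<omega> ^ i * cnj (W \<omega>) ^ j * (S \<omega> ^ (k - i) * cnj (S \<omega>) ^ (k - j))" for i j \<omega>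
  have [measurable]: "T i j \<in> borel_measurable M" for i j unfolding T_def by measurable
  have T_bound: "cmod (T i j \<omega>) \<le> B ^ (k - i) * B ^ (k - j)" if "\<omega> \<in> space M" for i j \<omega>
  proof -
    have "0 \<le> B" using S[OF that] norm_ge_zero[of "S \<omega>"] by linarith
    then show ?thesis using S[OF that] W[OF that]
      by (auto simp: T_def norm_mult norm_power intro!: mult_mono power_mono)
  qed
  have T_int: "integrable M (T i j)" for i j
    using T_bound by (intro integrable_const_bound AE_I2) auto
  have square: "complex_of_real (cmod z ^ (2 * m)) = z ^ m * cnj z ^ m" for z m
    unfolding power_mult of_real_power[of _ m] complex_norm_square power_mult_distrib by simp
  have diag: "T i i \<omega> = complex_of_real (cmod (S \<omega>) ^ (2 * (k - i)))" if "\<omega> \<in> space M" for i \<omega>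
  proof -
    have "W \<omega> ^ i * cnj (W \<omega>) ^ i = complex_of_real (cmod (W \<omega>) ^ (2 * i))"
      by (rule square[symmetric])
    then have "W \<omega> ^ i * cnj (W \<omega>) ^ i = 1" using W[OF that] by simp
    then show ?thesis unfolding T_def square by simp
  qed
  have "complex_of_real (expectation (\<lambda>\<omega>. cmod (W \<omega> + S \<omega>) ^ (2 * k))) =
      expectation (\<lambda>\<omega>. (W \<omega> + S \<omega>) ^ k * cnj (W \<omega> + S \<omega>) ^ k)"
    unfolding integral_complex_of_real[symmetric] square ..
  also have "\<dots> = expectation (\<lambda>\<omega>. \<Sum>i\<le>k. \<Sum>j\<le>k. of_nat (k choose i) * of_nat (k choose j) * T i j \<omega>)"
    unfolding complex_cnj_add binomial_ring sum_product T_def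
    by (intro arg_cong[of _ _ "integral\<^sup>L M"] ext sum.cong refl) (simp only: mult_ac)
  also have "\<dots> = (\<Sum>i\<le>k. \<Sum>j\<le>k. of_nat (k choose i) * of_nat (k choose j) * expectation (T i j))"
    using T_int by simp
  also have "\<dots> = (\<Sum>i\<le>k. \<Sum>j\<le>k. if j = i then of_nat (k choose i) ^ 2 * expectation (T i i) else 0)"
    using orth by (intro sum.cong refl) (auto simp: T_def[abs_def] power2_eq_square)
  also have "\<dots> = (\<Sum>i\<le>k. of_nat (k choose i) ^ 2 * expectation (T i i))"
    by simp
  also have "\<dots> = (\<Sum>i\<le>k. of_nat (k choose i) ^ 2 *
      complex_of_real (expectation (\<lambda>\<omega>. cmod (S \<omega>) ^ (2 * (k - i)))))"
    unfolding integral_complex_of_real[symmetric]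
    by (intro sum.cong refl arg_cong2[of _ _ _ _ "(*)"] Bochner_Integration.integral_cong diag) auto
  also have "\<dots> = complex_of_real
      (\<Sum>i\<le>k. (real (k choose i))\<^sup>2 * expectation (\<lambda>\<omega>. cmod (S \<omega>) ^ (2 * (k - i))))"
    by simp
  finally show ?thesis by (rule of_real_eq_iff[THEN iffD1])
qed

text \<open>One binomial coefficient absorbs the factorial, since their product is
  \<open>fact k / fact i\<close>, at most \<open>fact k\<close>. The rest sums to a power of
  \<open>1 + a\<close> by the binomial theorem.\<close>

lemma sum_binomial_square_fact_le:
  "(\<Sum>i\<le>k. (real (k choose i))\<^sup>2 * (fact (k - i) * real a ^ (k - i))) \<le> fact k * real (Suc a) ^ k"
proof -
  have "(\<Sum>i\<le>k. (real (k choose i))\<^sup>2 * (fact (k - i) * real a ^ (k - i))) \<le>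
      (\<Sum>i\<le>k. fact k * (real (k choose i) * real a ^ (k - i)))"
  proof (rule sum_mono)
    fix i assume "i \<in> {..k}"
    then have "real (k choose i) * fact (k - i) = fact k / fact i"
      by (simp add: binomial_fact)
    also have "\<dots> \<le> fact k"
      by (simp add: divide_le_eq fact_ge_1)
    finally have "real (k choose i) * fact (k - i) * (real (k choose i) * real a ^ (k - i)) \<le>
        fact k * (real (k choose i) * real a ^ (k - i))"
      by (intro mult_right_mono) auto
    then show "(real (k choose i))\<^sup>2 * (fact (k - i) * real a ^ (k - i)) \<le>
        fact k * (real (k choose i) * real a ^ (k - i))"
      by (simp add: power2_eq_square mult_ac)
  qed
  also have "\<dots> = fact k * (1 + real a) ^ k"
    by (simp add: binomial_ring sum_distrib_left)
  finally show ?thesis by simp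
qed

lemma (in prob_space) indep_vars_expectation_mult:
  fixes X :: "'i \<Rightarrow> 'a \<Rightarrow> complex"
  assumes ind: "indep_vars (\<lambda>_. borel) X I" and A: "A \<subseteq> I" and v: "v \<in> I" "v \<notin> A"
    and G: "G \<in> borel_measurable (PiM A (\<lambda>_. borel))" and g: "g \<in> borel_measurable borel"
    and int: "integrable M (\<lambda>\<omega>. G (\<lambda>i\<in>A. X i \<omega>))" "integrable M (\<lambda>\<omega>. g (X v \<omega>))"
  shows "expectation (\<lambda>\<omega>. G (\<lambda>i\<in>A. X i \<omega>) * g (X v \<omega>) :: complex) =
    expectation (\<lambda>\<omega>. G (\<lambda>i\<in>A. X i \<omega>)) * expectation (\<lambda>\<omega>. g (X v \<omega>))"
proof -
  have "indep_var (PiM A (\<lambda>_. borel)) (\<lambda>\<omega>. \<lambda>i\<in>A. X i \<omega>) (PiM {v} (\<lambda>_. borel)) (\<lambda>\<omega>. \<lambda>i\<in>{v}. X i \<omega>)"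
    using A v by (intro indep_var_restrict[OF ind]) auto
  moreover have "(\<lambda>f. g (f v)) \<in> borel_measurable (PiM {v} (\<lambda>_. borel))"
    using g by (intro measurable_compose[OF measurable_component_singleton[of v]]) auto
  ultimately have "indep_var borel (G \<circ> (\<lambda>\<omega>. \<lambda>i\<in>A. X i \<omega>))
      borel ((\<lambda>f. g (f v)) \<circ> (\<lambda>\<omega>. \<lambda>i\<in>{v}. X i \<omega>))"
    using G by (intro indep_var_compose)
  then have "indep_var borel (\<lambda>\<omega>. G (\<lambda>i\<in>A. X i \<omega>)) borel (\<lambda>\<omega>. g (X v \<omega>))"
    by (simp add: comp_def)
  from indep_var_lebesgue_integral[OF this int] show ?thesis .
qed

text \<open>Induction on the number of terms. Each new term contains a variable independent of all
  others present, so \<open>moment_add_unimodular\<close> gives a recursion for the moments, and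
  \<open>sum_binomial_square_fact_le\<close> shows that the bound \<open>fact k * a ^ k\<close>
  propagates.\<close>

lemma (in prob_space) chain_moment:
  fixes X :: "'i \<Rightarrow> 'a \<Rightarrow> complex" and f :: "nat \<Rightarrow> 'i"
  assumes ind: "indep_vars (\<lambda>_. borel) X I"
    and norm: "\<And>i \<omega>. i \<in> I \<Longrightarrow> \<omega> \<in> space M \<Longrightarrow> cmod (X i \<omega>) = 1"
    and mean: "\<And>i j. i \<in> I \<Longrightarrow> 0 < j \<Longrightarrow> expectation (\<lambda>\<omega>. X i \<omega> ^ j) = 0"
    and f: "inj_on f {..<N}" "f ` {..<N} \<subseteq> I"
    and c: "\<And>r. cmod (c r) = 1" and p: "0 < p" "a + p \<le> N"
  shows "expectation (\<lambda>\<omega>. cmod (\<Sum>r<a. c r * (X (f (r + p)) \<omega> * cnj (X (f r) \<omega>))) ^ (2 * k))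
    \<le> fact k * real a ^ k"
  using p(2)
proof (induction a arbitrary: k)
  case 0
  then show ?case by (cases k) (auto simp: prob_space)
next
  case (Suc a)
  define S where "S \<omega> = (\<Sum>r<a. c r * (X (f (r + p)) \<omega> * cnj (X (f r) \<omega>)))" for \<omega>
  define W where "W \<omega> = c a * (X (f (a + p)) \<omega> * cnj (X (f a) \<omega>))" for \<omega>
  have fI: "f r \<in> I" if "r < N" for r using f that by auto
  have X_meas [measurable]: "X i \<in> borel_measurable M" if "i \<in> I" for i
    using ind that by (auto simp: indep_vars_def)
  have [measurable]: "X (f a) \<in> borel_measurable M" "X (f (a + p)) \<in> borel_measurable M"
    using X_meas fI Suc.prems by auto
  have S_meas [measurable]: "S \<in> borel_measurable M"
    unfolding S_def
  proof (rule borel_measurable_sum)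
    fix r assume "r \<in> {..<a}"
    then have [measurable]: "X (f r) \<in> borel_measurable M" "X (f (r + p)) \<in> borel_measurable M"
      using X_meas fI Suc.prems by auto
    show "(\<lambda>\<omega>. c r * (X (f (r + p)) \<omega> * cnj (X (f r) \<omega>))) \<in> borel_measurable M"
      by measurable
  qed
  have W_meas [measurable]: "W \<in> borel_measurable M"
    unfolding W_def by measurable
  have norm_term: "cmod (c r * (X (f (r + p)) \<omega> * cnj (X (f r) \<omega>))) = 1"
    if "r \<le> a" "\<omega> \<in> space M" for r \<omega>
    using that Suc.prems c norm[OF fI] p by (simp add: norm_mult)
  have S_bound: "cmod (S \<omega>) \<le> real a" if "\<omega> \<in> space M" for \<omega>
  proof -
    have "cmod (S \<omega>) \<le> (\<Sum>r<a. 1)"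
      unfolding S_def using norm_term that by (intro sum_norm_le) auto
    then show ?thesis by simp
  qed
  \<comment> \<open>On the unit circle a conjugate is an inverse, so the product is a positive power
    of \<open>X i\<close> or the conjugate of one.\<close>
  have mean': "expectation (\<lambda>\<omega>. X i \<omega> ^ m * cnj (X i \<omega>) ^ j) = 0" if i: "i \<in> I" and "m \<noteq> j" for i m j
  proof -
    have unit: "X i \<omega> * cnj (X i \<omega>) = 1" if "\<omega> \<in> space M" for \<omega>
      using norm[OF i that] by (simp add: complex_norm_square[symmetric])
    show ?thesis
    proof (cases "j < m")
      case True
      have "X i \<omega> ^ m * cnj (X i \<omega>) ^ j = X i \<omega> ^ (m - j)" if "\<omega> \<in> space M" for \<omega>
      proof -
        have "X i \<omega> ^ m * cnj (X i \<omega>) ^ j = X i \<omega> ^ (m - j) * (X i \<omega> * cnj (X i \<omega>)) ^ j"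
          using True by (simp add: power_mult_distrib mult.assoc[symmetric] flip: power_add)
        then show ?thesis by (simp add: unit that)
      qed
      then have "expectation (\<lambda>\<omega>. X i \<omega> ^ m * cnj (X i \<omega>) ^ j) = expectation (\<lambda>\<omega>. X i \<omega> ^ (m - j))"
        by (intro Bochner_Integration.integral_cong) auto
      then show ?thesis using mean[OF i] True by simp
    next
      case False
      then have less: "m < j" using that by simp
      have "X i \<omega> ^ m * cnj (X i \<omega>) ^ j = cnj (X i \<omega> ^ (j - m))" if "\<omega> \<in> space M" for \<omega>
      proof -
        have "X i \<omega> ^ m * cnj (X i \<omega>) ^ j = cnj (X i \<omega>) ^ (j - m) * (X i \<omega> * cnj (X i \<omega>)) ^ m"
          using less by (simp add: power_mult_distrib mult_ac flip: power_add)
        then show ?thesis by (simp add: unit that)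
      qed
      then have "expectation (\<lambda>\<omega>. X i \<omega> ^ m * cnj (X i \<omega>) ^ j) = expectation (\<lambda>\<omega>. cnj (X i \<omega> ^ (j - m)))"
        by (intro Bochner_Integration.integral_cong) auto
      also have "\<dots> = cnj (expectation (\<lambda>\<omega>. X i \<omega> ^ (j - m)))"
        by (rule Bochner_Integration.integral_cnj)
      finally show ?thesis using mean[OF i] less by simp
    qed
  qed
  \<comment> \<open>The index \<open>f (a + p)\<close> occurs in no earlier term, so \<open>W\<close> averages out.\<close>
  have orth: "expectation (\<lambda>\<omega>. W \<omega> ^ i * cnj (W \<omega>) ^ j * (S \<omega> ^ m * cnj (S \<omega>) ^ m')) = 0"
    if "i \<noteq> j" for i j m m'
  proof -
    define A where "A = f ` {..<a + p}"
    define v where "v = f (a + p)"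
    define g where "g z = z ^ i * cnj z ^ j" for z :: complex
    define S' where "S' y = (\<Sum>r<a. c r * (y (f (r + p)) * cnj (y (f r))))" for y :: "'i \<Rightarrow> complex"
    \<comment> \<open>\<open>G\<close> collects all factors except the powers of \<open>X v\<close>.
      The exponents of \<open>y (f a)\<close> are swapped because it enters \<open>W\<close>
      conjugated.\<close>
    define G where "G y = c a ^ i * cnj (c a) ^ j * cnj (y (f a)) ^ i * y (f a) ^ j *
        (S' y ^ m * cnj (S' y) ^ m')" for y :: "'i \<Rightarrow> complex"
    have fA: "f r \<in> A" if "r < a + p" for r using that by (auto simp: A_def)
    have A: "A \<subseteq> I" using f Suc.prems by (auto simp: A_def)
    have v: "v \<in> I" using fI Suc.prems by (simp add: v_def)
    have vA: "v \<notin> A"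
      using f(1) Suc.prems by (auto simp: v_def A_def dest!: inj_onD)
    have S': "S' (\<lambda>i\<in>A. X i \<omega>) = S \<omega>" for \<omega>
      unfolding S'_def S_def by (intro sum.cong refl) (simp add: fA)
    have comp: "(\<lambda>y. y (f r)) \<in> borel_measurable (PiM A (\<lambda>_. borel :: complex measure))"
      if "r < a + p" for r
      using fA[OF that] by (rule measurable_component_singleton)
    have [measurable]: "S' \<in> borel_measurable (PiM A (\<lambda>_. borel))"
      unfolding S'_def
    proof (rule borel_measurable_sum)
      fix r assume "r \<in> {..<a}"
      then have [measurable]: "(\<lambda>y. y (f r)) \<in> borel_measurable (PiM A (\<lambda>_. borel :: complex measure))"
        "(\<lambda>y. y (f (r + p))) \<in> borel_measurable (PiM A (\<lambda>_. borel :: complex measure))"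
        using comp by auto
      show "(\<lambda>y. c r * (y (f (r + p)) * cnj (y (f r)))) \<in> borel_measurable (PiM A (\<lambda>_. borel))"
        by measurable
    qed
    have G_meas: "G \<in> borel_measurable (PiM A (\<lambda>_. borel))"
    proof -
      have [measurable]: "(\<lambda>y. y (f a)) \<in> borel_measurable (PiM A (\<lambda>_. borel :: complex measure))"
        using comp[of a] p by simp
      show ?thesis unfolding G_def by measurable
    qed
    have g_meas [measurable]: "g \<in> borel_measurable borel" unfolding g_def by measurable
    have G_eq: "G (\<lambda>i\<in>A. X i \<omega>) = c a ^ i * cnj (c a) ^ j * cnj (X (f a) \<omega>) ^ i * X (f a) \<omega> ^ j *
        (S \<omega> ^ m * cnj (S \<omega>) ^ m')" for \<omega>
      using fA[of a] p by (simp add: G_def S')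
    have "expectation (\<lambda>\<omega>. W \<omega> ^ i * cnj (W \<omega>) ^ j * (S \<omega> ^ m * cnj (S \<omega>) ^ m')) =
        expectation (\<lambda>\<omega>. G (\<lambda>i\<in>A. X i \<omega>) * g (X v \<omega>))"
      unfolding G_eq W_def g_def v_def by (simp add: power_mult_distrib mult_ac)
    also have "\<dots> = expectation (\<lambda>\<omega>. G (\<lambda>i\<in>A. X i \<omega>)) * expectation (\<lambda>\<omega>. g (X v \<omega>))"
    proof (rule indep_vars_expectation_mult[OF ind A v vA G_meas g_meas])
      have "cmod (G (\<lambda>i\<in>A. X i \<omega>)) \<le> real a ^ m * real a ^ m'" if "\<omega> \<in> space M" for \<omega>
        unfolding G_eq norm_mult norm_power complex_mod_cnj
        using that S_bound[OF that] c norm[OF fI[of a]] Suc.prems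
        by (auto intro!: mult_mono power_mono)
      moreover have "(\<lambda>\<omega>. G (\<lambda>i\<in>A. X i \<omega>)) \<in> borel_measurable M"
        unfolding G_eq by measurable
      ultimately show "integrable M (\<lambda>\<omega>. G (\<lambda>i\<in>A. X i \<omega>))"
        by (intro integrable_const_bound AE_I2) auto
      show "integrable M (\<lambda>\<omega>. g (X v \<omega>))"
        using norm[OF v] X_meas[OF v]
        by (intro integrable_const_bound[of _ 1] AE_I2) (auto simp: g_def norm_mult norm_power)
    qed
    also have "expectation (\<lambda>\<omega>. g (X v \<omega>)) = 0"
      unfolding g_def by (rule mean'[OF v that])
    finally show ?thesis by simp
  qed
  have "expectation (\<lambda>\<omega>. cmod (\<Sum>r<Suc a. c r * (X (f (r + p)) \<omega> * cnj (X (f r) \<omega>))) ^ (2 * k)) =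
      expectation (\<lambda>\<omega>. cmod (W \<omega> + S \<omega>) ^ (2 * k))"
    by (simp add: W_def S_def add.commute)
  also have "\<dots> = (\<Sum>i\<le>k. (real (k choose i))\<^sup>2 * expectation (\<lambda>\<omega>. cmod (S \<omega>) ^ (2 * (k - i))))"
    using norm_term[of a]
    by (intro moment_add_unimodular[OF S_meas W_meas S_bound _ orth]) (auto simp: W_def)
  also have "\<dots> \<le> (\<Sum>i\<le>k. (real (k choose i))\<^sup>2 * (fact (k - i) * real a ^ (k - i)))"
    using Suc by (intro sum_mono mult_left_mono) (auto simp: S_def)
  also have "\<dots> \<le> fact k * real (Suc a) ^ k"
    by (rule sum_binomial_square_fact_le)
  finally show ?case .
qed

section \<open>Random window\<close>

lemma borel_measurable_cis [measurable]: "cis \<in> borel_measurable borel"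
  by (intro borel_measurable_continuous_onI continuous_intros)

lemma cis_torus_uniform_moment:
  assumes "0 < j"
  shows "(\<integral>\<theta>. cis \<theta> ^ j \<partial>uniform_measure lborel {0..2 * pi}) = 0"
proof -
  have "uniform_measure lborel {0..2 * pi} =
      density lborel (\<lambda>x. ennreal (indicator {0..2 * pi} x / (2 * pi)))"
    unfolding uniform_measure_def
    by (intro arg_cong2[of _ _ _ _ density] ext)
      (auto simp: divide_ennreal[symmetric] split: split_indicator)
  then have "(\<integral>\<theta>. cis \<theta> ^ j \<partial>uniform_measure lborel {0..2 * pi}) =
      (\<integral>\<theta>. (indicator {0..2 * pi} \<theta> / (2 * pi)) *\<^sub>R cis \<theta> ^ j \<partial>lborel)"
    by (simp only:) (subst integral_density, auto)
  also have "\<dots> = (1 / (2 * pi)) *\<^sub>R (\<integral>\<theta>. indicator {0..2 * pi} \<theta> *\<^sub>R cis (real j * \<theta>) \<partial>lborel)"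
    by (subst integral_scaleR_right[symmetric]) (simp add: Complex.DeMoivre)
  \<comment> \<open>The antiderivative \<open>cis (j * \<theta>) / (\<i> * j)\<close> takes the same
    value at both ends of the period, so the moment vanishes.\<close>
  also have "(\<integral>\<theta>. indicator {0..2 * pi} \<theta> *\<^sub>R cis (real j * \<theta>) \<partial>lborel) =
      cis (real j * (2 * pi)) / (\<i> * of_nat j) - cis (real j * 0) / (\<i> * of_nat j)"
  proof (intro integral_FTC_Icc continuous_intros)
    fix x S
    have "((\<lambda>\<theta>. cis (real j * \<theta>) / (\<i> * of_nat j)) has_derivative
        (\<lambda>h. (real j * h) *\<^sub>R (\<i> * cis (real j * x)) / (\<i> * of_nat j))) (at x within S)"
      using assms by (auto intro!: derivative_eq_intros simp: divide_inverse)
    moreover have "(\<lambda>h. (real j * h) *\<^sub>R (\<i> * cis (real j * x)) / (\<i> * of_nat j)) =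
        (\<lambda>h. h *\<^sub>R cis (real j * x))"
      using assms by (auto simp: fun_eq_iff scaleR_conv_of_real mult_ac)
    ultimately show "((\<lambda>\<theta>. cis (real j * \<theta>) / (\<i> * of_nat j)) has_vector_derivative
        cis (real j * x)) (at x within S)"
      by (simp add: has_vector_derivative_def)
  qed simp
  also have "cis (real j * (2 * pi)) = 1"
    using cis_multiple_2pi[of "real j"] by (simp add: mult_ac)
  finally show ?thesis by simp
qed

text \<open>The \<open>\<epsilon>\<^sub>q\<close> have modulus \<open>1\<close> only almost surely; replacing them by their unimodular
  parts makes all chaoses bounded everywhere.\<close>

definition unimodular_part :: "complex \<Rightarrow> complex" where
  "unimodular_part z = (if cmod z = 1 then z else 1)"

lemma norm_unimodular_part [simp]: "cmod (unimodular_part z) = 1"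
  by (simp add: unimodular_part_def)

lemma borel_measurable_unimodular_part [measurable]: "unimodular_part \<in> borel_measurable borel"
  unfolding unimodular_part_def by measurable

lemma (in prob_space) torus_uniform_moment:
  assumes X: "X \<in> borel_measurable M" "distr M borel X = torus_uniform" and "0 < j"
  shows "expectation (\<lambda>\<omega>. unimodular_part (X \<omega>) ^ j) = 0"
proof -
  have "expectation (\<lambda>\<omega>. unimodular_part (X \<omega>) ^ j) = (\<integral>z. unimodular_part z ^ j \<partial>distr M borel X)"
    using X(1) by (subst integral_distr) auto
  also have "\<dots> = (\<integral>\<theta>. unimodular_part (cis \<theta>) ^ j \<partial>uniform_measure lborel {0..2 * pi})"
    unfolding X torus_uniform_def by (subst integral_distr) auto
  also have "\<dots> = 0"
    using cis_torus_uniform_moment[OF assms(3)] by (simp add: unimodular_part_def)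
  finally show ?thesis .
qed

lemma (in prob_space) torus_uniform_AE:
  assumes X: "X \<in> borel_measurable M" "distr M borel X = torus_uniform"
  shows "AE \<omega> in M. unimodular_part (X \<omega>) = X \<omega>"
proof -
  have "AE z in torus_uniform. unimodular_part z = z"
    unfolding torus_uniform_def by (subst AE_distr_iff) (auto simp: unimodular_part_def)
  then show ?thesis
    unfolding X(2)[symmetric] using X(1) by (subst (asm) AE_distr_iff) auto
qed

text \<open>The sum over \<open>q\<close> is cut into the halves \<open>q < m\<close> and \<open>q \<ge> m\<close>. For \<open>p \<le> m\<close> neither half
  closes a cycle of \<open>q \<mapsto> q + p\<close>, so each is a chain as in \<open>chain_moment\<close>.\<close>

definition half_sum :: "nat \<Rightarrow> (nat \<Rightarrow> complex) \<Rightarrow> nat \<Rightarrow> nat \<Rightarrow> nat \<Rightarrow> complex" where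
  "half_sum m e l p s = (\<Sum>r<m. unit_char (2 * m) (int l * int (r + s)) *
     (e ((r + p + s) mod (2 * m)) * cnj (e ((r + s) mod (2 * m)))))"

lemma ambiguity_half_sums:
  assumes "0 < m"
  shows "ambiguity (2 * m) (periodize (2 * m) (vec (2 * m) (\<lambda>q. 1 / of_real (sqrt (real (2 * m))) * e q)))
      (int l) (int p) = (half_sum m e l p 0 + half_sum m e l p m) / of_nat (2 * m)"
proof -
  define n where "n = 2 * m"
  have n: "0 < n" using assms by (simp add: n_def)
  have sq: "complex_of_real (sqrt n) * complex_of_real (sqrt n) = of_nat n"
    by (simp flip: of_real_mult)
  define H where "H = periodize n (vec n (\<lambda>q. 1 / of_real (sqrt (real n)) * e q))"
  have H: "H (int q) = 1 / of_real (sqrt n) * e (q mod n)" for q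
    using n by (simp add: H_def periodize_def nat_mod_distrib flip: of_nat_mod)
  define f where "f q = unit_char n (int l * int q) * (e ((q + p) mod n) * cnj (e (q mod n)))" for q
  have "ambiguity n H (int l) (int p) = (\<Sum>q<n. f q / of_nat n)"
    unfolding ambiguity_def
  proof (intro sum.cong refl)
    fix q
    have "H (int q + int p) = 1 / of_real (sqrt n) * e ((q + p) mod n)"
      using H[of "q + p"] by simp
    then show "unit_char n (int l * int q) * (H (int q + int p) * cnj (H (int q))) = f q / of_nat n"
      by (simp add: H f_def sq)
  qed
  also have "\<dots> = (\<Sum>q<n. f q) / of_nat n" by (simp add: sum_divide_distrib)
  also have "(\<Sum>q<n. f q) = (\<Sum>q<m. f q) + (\<Sum>q=m..<m + m. f q)"
    unfolding n_def mult_2 by (simp add: lessThan_atLeast0 sum.atLeastLessThan_concat)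
  also have "(\<Sum>q=m..<m + m. f q) = (\<Sum>r<m. f (r + m))"
    using sum.shift_bounds_nat_ivl[of f 0 m m] by (simp add: lessThan_atLeast0)
  finally show ?thesis
    unfolding H_def n_def f_def half_sum_def by (simp add: add_ac)
qed

text \<open>\<open>chain_moment\<close> is applied with \<open>m\<close> terms along the
  \<open>2 * m\<close> indices \<open>f r\<close>; its condition on the length is
  \<open>p \<le> m\<close>. The squared modulus then has the factorial moments with
  \<open>b = m\<close>.\<close>

lemma (in prob_space) half_sum_tail:
  assumes ind: "indep_vars (\<lambda>_. borel) \<epsilon> {..<2 * m}"
    and distr: "\<And>q. q < 2 * m \<Longrightarrow> distr M borel (\<epsilon> q) = torus_uniform"
    and m: "0 < m" and p: "0 < p" "p \<le> m"
  shows "prob {\<omega> \<in> space M. 2 * real m * L \<le> (cmod (half_sum m (\<lambda>q. unimodular_part (\<epsilon> q \<omega>)) l p s))\<^sup>2}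
      \<le> 2 * exp (- L)"
    and "{\<omega> \<in> space M. 2 * real m * L \<le> (cmod (half_sum m (\<lambda>q. unimodular_part (\<epsilon> q \<omega>)) l p s))\<^sup>2} \<in> events"
proof -
  define X where "X q \<omega> = unimodular_part (\<epsilon> q \<omega>)" for q \<omega>
  define f where "f r = (r + s) mod (2 * m)" for r
  have eps: "\<epsilon> q \<in> borel_measurable M" if "q < 2 * m" for q
    using ind that by (auto simp: indep_vars_def)
  have X: "indep_vars (\<lambda>_. borel) X {..<2 * m}"
    unfolding X_def by (rule indep_vars_compose2[OF ind]) simp
  have f: "f r < 2 * m" for r using m by (simp add: f_def)
  have [measurable]: "X (f r) \<in> borel_measurable M" for r
    using X f by (auto simp: indep_vars_def)
  have inj: "inj_on f {..<2 * m}"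
  proof (rule inj_onI)
    fix x y assume xy: "x \<in> {..<2 * m}" "y \<in> {..<2 * m}" "f x = f y"
    then have "[x + s = y + s] (mod (2 * m))" by (simp add: f_def cong_def)
    then have "[x = y] (mod (2 * m))" by (simp add: cong_add_rcancel_nat)
    with xy show "x = y" by (simp add: cong_def)
  qed
  have half: "half_sum m (\<lambda>q. unimodular_part (\<epsilon> q \<omega>)) l p s = (\<Sum>r<m. unit_char (2 * m) (int l * int (r + s)) *
      (X (f (r + p)) \<omega> * cnj (X (f r) \<omega>)))" for \<omega>
    by (simp add: half_sum_def X_def f_def)
  have [measurable]: "(\<lambda>\<omega>. half_sum m (\<lambda>q. unimodular_part (\<epsilon> q \<omega>)) l p s) \<in> borel_measurable M"
    unfolding half by measurable
  show "{\<omega> \<in> space M. 2 * real m * L \<le> (cmod (half_sum m (\<lambda>q. unimodular_part (\<epsilon> q \<omega>)) l p s))\<^sup>2} \<in> events"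
    by measurable
  show "prob {\<omega> \<in> space M. 2 * real m * L \<le> (cmod (half_sum m (\<lambda>q. unimodular_part (\<epsilon> q \<omega>)) l p s))\<^sup>2}
      \<le> 2 * exp (- L)"
  proof (rule factorial_moments_tail)
    show "0 \<le> (cmod (half_sum m (\<lambda>q. unimodular_part (\<epsilon> q \<omega>)) l p s))\<^sup>2 \<and>
        (cmod (half_sum m (\<lambda>q. unimodular_part (\<epsilon> q \<omega>)) l p s))\<^sup>2 \<le> (real m)\<^sup>2" for \<omega>
    proof -
      have "cmod (half_sum m (\<lambda>q. unimodular_part (\<epsilon> q \<omega>)) l p s) \<le> (\<Sum>r<m. 1)"
        unfolding half by (intro sum_norm_le) (simp add: norm_mult X_def)
      then show ?thesis by (simp add: power_mono)
    qed
    fix k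
    show "expectation (\<lambda>\<omega>. (cmod (half_sum m (\<lambda>q. unimodular_part (\<epsilon> q \<omega>)) l p s))\<^sup>2 ^ k)
        \<le> fact k * real m ^ k"
      unfolding half power_mult[symmetric]
    proof (rule chain_moment[OF X])
      show "expectation (\<lambda>\<omega>. X i \<omega> ^ j) = 0" if "i \<in> {..<2 * m}" "0 < j" for i j
        unfolding X_def using that by (intro torus_uniform_moment eps distr) auto
    qed (use inj f p in \<open>auto simp: X_def\<close>)
  qed (use m in auto)
qed

text \<open>Outside the bad events every half sum has modulus below \<open>sqrt (n * L)\<close>, so
  the ambiguity function stays below \<open>2 * sqrt (L / n)\<close>, which is what the bound on
  \<open>k\<close> tolerates.\<close>

lemma random_window_recovery:
  assumes M: "prob_space M" and ind: "prob_space.indep_vars M (\<lambda>_. borel) \<epsilon> {..<n}"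
    and distr: "\<forall>q<n. distr M borel (\<epsilon> q) = torus_uniform"
    and n: "0 < n" "even n" and k: "0 < k" and t: "0 < t"
    and bound: "real k \<le> 1 / 4 * sqrt (real n / (2 * ln (real n) + ln 4 + t)) + 1 / 2"
  shows "measure M {\<omega> \<in> space M. bp_recovers_all_sparse n k (random_window n \<epsilon> \<omega>)} \<ge> 1 - exp (- t)"
proof -
  interpret prob_space M by fact
  obtain m where nm: "n = 2 * m" using n by blast
  have m: "0 < m" using n nm by simp
  define L where "L = 2 * ln (real n) + ln 4 + t"
  have L: "0 < L"
    using n t by (simp add: L_def add_nonneg_pos)
  have eps: "\<epsilon> q \<in> borel_measurable M" if "q < n" for q
    using ind that by (auto simp: indep_vars_def)
  define e where "e \<omega> q = unimodular_part (\<epsilon> q \<omega>)" for \<omega> q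
  define Bad where "Bad = (\<lambda>(l, p, s). {\<omega> \<in> space M. 2 * real m * L \<le> (cmod (half_sum m (e \<omega>) l p s))\<^sup>2})"
  \<comment> \<open>All modulations, the translations up to \<open>m\<close>, and the two halves:
    \<open>n * m * 2\<close>, that is \<open>n ^ 2\<close>, events.\<close>
  define J where "J = {..<n} \<times> {1..m} \<times> {0, m}"
  have Bad: "prob (Bad j) \<le> 2 * exp (- L)" "Bad j \<in> events" if "j \<in> J" for j
  proof -
    obtain l p s where j: "j = (l, p, s)" and p: "0 < p" "p \<le> m"
      using \<open>j \<in> J\<close> by (auto simp: J_def)
    have distr': "distr M borel (\<epsilon> q) = torus_uniform" if "q < 2 * m" for q
      using distr that nm by simp
    show "prob (Bad j) \<le> 2 * exp (- L)" "Bad j \<in> events"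
      unfolding Bad_def j prod.case e_def
      using half_sum_tail[OF ind[unfolded nm] distr' m p] by blast+
  qed
  have "prob (\<Union>j\<in>J. Bad j) \<le> (\<Sum>j\<in>J. prob (Bad j))"
    using Bad by (intro finite_measure_subadditive_finite) (auto simp: J_def)
  also have "\<dots> \<le> (\<Sum>j\<in>J. 2 * exp (- L))" by (intro sum_mono Bad)
  also have "\<dots> = real n ^ 2 * (2 * exp (- L))"
    using m by (simp add: J_def nm card_cartesian_product power2_eq_square)
  \<comment> \<open>The term \<open>2 * ln n\<close> in \<open>L\<close> pays for the
    \<open>n ^ 2\<close> events. The term \<open>ln 4\<close> covers the factor \<open>2\<close> of
    each tail and leaves another factor \<open>2\<close> to spare.\<close>
  also have "exp (- L) = exp (- t) / (4 * real n ^ 2)"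
  proof -
    have "- L = - t - (ln 4 + (ln (real n) + ln (real n)))" by (simp add: L_def)
    also have "exp \<dots> = exp (- t) / (4 * (real n * real n))"
      using n by (simp only: exp_diff exp_add exp_ln of_nat_0_less_iff zero_less_numeral)
    finally show ?thesis by (simp add: power2_eq_square)
  qed
  also have "real n ^ 2 * (2 * (exp (- t) / (4 * real n ^ 2))) = exp (- t) / 2"
    using n by simp
  also have "\<dots> \<le> exp (- t)" by simp
  finally have union: "prob (\<Union>j\<in>J. Bad j) \<le> exp (- t)" .
  have good: "bp_recovers_all_sparse n k (vec n (\<lambda>q. 1 / of_real (sqrt (real n)) * e \<omega> q))"
    if \<omega>: "\<omega> \<in> space M - (\<Union>j\<in>J. Bad j)" for \<omega>
  proof (rule ambiguity_recovery[OF _ n(1) k])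
    let ?h = "vec n (\<lambda>q. 1 / of_real (sqrt (real n)) * e \<omega> q)"
    have sq: "complex_of_real (sqrt n) * complex_of_real (sqrt n) = of_nat n"
      by (simp flip: of_real_mult)
    have "e \<omega> q * cnj (e \<omega> q) = 1" for q
      by (simp add: e_def complex_norm_square[symmetric])
    then show "?h $ q * cnj (?h $ q) = 1 / of_nat n" if "q < n" for q
      using that by (simp add: sq)
    fix l p assume l: "l < n" and p: "0 < p" "2 * p \<le> n"
    have half: "cmod (half_sum m (e \<omega>) l p s) < sqrt (real n * L)" if "s \<in> {0, m}" for s
    proof -
      have "(l, p, s) \<in> J" using that l p by (auto simp: J_def nm)
      then have "(cmod (half_sum m (e \<omega>) l p s))\<^sup>2 < real n * L"
        using \<omega> by (force simp: Bad_def nm)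
      then show ?thesis by (rule real_less_rsqrt)
    qed
    have "cmod (ambiguity n (periodize n ?h) (int l) (int p)) =
        cmod (half_sum m (e \<omega>) l p 0 + half_sum m (e \<omega>) l p m) / real n"
      unfolding nm ambiguity_half_sums[OF m] norm_divide norm_of_nat ..
    also have "\<dots> \<le> (cmod (half_sum m (e \<omega>) l p 0) + cmod (half_sum m (e \<omega>) l p m)) / real n"
      by (intro divide_right_mono norm_triangle_ineq) simp
    also have "\<dots> < (2 * sqrt (real n * L)) / real n"
      using half[of 0] half[of m] n by (intro divide_strict_right_mono) auto
    finally have amb: "cmod (ambiguity n (periodize n ?h) (int l) (int p)) < 2 * sqrt (real n * L) / real n" .
    \<comment> \<open>The constants \<open>1 / 4\<close> and \<open>1 / 2\<close> in the bound on
      \<open>k\<close> yield the factor \<open>1 / 2\<close> here, which cancels the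
      \<open>2\<close> from adding two halves.\<close>
    have "2 * real k - 1 \<le> sqrt (real n / L) / 2"
      using bound by (simp add: L_def)
    moreover have "0 < 2 * real k - 1" using k by simp
    ultimately have "(2 * real k - 1) * cmod (ambiguity n (periodize n ?h) (int l) (int p)) <
        sqrt (real n / L) / 2 * (2 * sqrt (real n * L) / real n)"
      using amb by (intro mult_le_less_imp_less) auto
    also have "\<dots> = sqrt (real n / L * (real n * L)) / real n"
      by (simp only: real_sqrt_mult) simp
    also have "real n / L * (real n * L) = (real n)\<^sup>2"
      using L by (simp add: power2_eq_square)
    also have "sqrt ((real n)\<^sup>2) / real n = 1" using n by simp
    finally show "(2 * real k - 1) * cmod (ambiguity n (periodize n ?h) (int l) (int p)) < 1" .
  qed simp
  \<comment> \<open>Recovery was shown for the unimodular modification of the window, which agrees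
    with the given window almost surely.\<close>
  have "AE \<omega> in M. \<forall>q\<in>{..<n}. e \<omega> q = \<epsilon> q \<omega>"
    unfolding e_def using eps distr by (intro AE_finite_allI torus_uniform_AE) auto
  then have "AE \<omega> in M. \<omega> \<in> space M - (\<Union>j\<in>J. Bad j) \<longrightarrow>
      \<omega> \<in> {\<omega> \<in> space M. bp_recovers_all_sparse n k (random_window n \<epsilon> \<omega>)}"
  proof (rule AE_mp, intro AE_I2 impI)
    fix \<omega> assume eq: "\<forall>q\<in>{..<n}. e \<omega> q = \<epsilon> q \<omega>" and \<omega>: "\<omega> \<in> space M - (\<Union>j\<in>J. Bad j)"
    have "random_window n \<epsilon> \<omega> = vec n (\<lambda>q. 1 / of_real (sqrt (real n)) * e \<omega> q)"
      using eq by (auto simp: random_window_def)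
    with good[OF \<omega>] \<omega> show "\<omega> \<in> {\<omega> \<in> space M. bp_recovers_all_sparse n k (random_window n \<epsilon> \<omega>)}"
      by simp
  qed
  \<comment> \<open>Measurability of the recovery event turns the almost sure inclusion into an
    inequality of probabilities.\<close>
  then have "prob (space M - (\<Union>j\<in>J. Bad j)) \<le>
      prob {\<omega> \<in> space M. bp_recovers_all_sparse n k (random_window n \<epsilon> \<omega>)}"
    using recovery_set_measurable[OF n(1) eps] by (rule finite_measure_mono_AE)
  moreover have "prob (space M - (\<Union>j\<in>J. Bad j)) = 1 - prob (\<Union>j\<in>J. Bad j)"
    using Bad by (intro prob_compl sets.finite_UN) (auto simp: J_def)
  ultimately show ?thesis using union by simp
qed

theorem theorem2p4:
  shows
    "(\<forall>n k :: nat.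
        prime n \<longrightarrow> 5 \<le> n \<longrightarrow> 0 < k \<longrightarrow> real k < (sqrt (real n) + 1) / 2 \<longrightarrow>
        bp_recovers_all_sparse n k (alltop_window n))
     \<and>
     (\<forall>(n :: nat) (k :: nat) (t :: real) (M :: 'w measure) (\<epsilon> :: nat \<Rightarrow> 'w \<Rightarrow> complex).
        0 < n \<longrightarrow> even n \<longrightarrow> 0 < k \<longrightarrow> 0 < t \<longrightarrow>
        prob_space M \<longrightarrow>
        prob_space.indep_vars M (\<lambda>_. borel) \<epsilon> {..<n} \<longrightarrow>
        (\<forall>q<n. distr M borel (\<epsilon> q) = torus_uniform) \<longrightarrow>
        real k \<le> 1 / 4 * sqrt (real n / (2 * ln (real n) + ln 4 + t)) + 1 / 2 \<longrightarrow>
        measure M {\<omega> \<in> space M. bp_recovers_all_sparse n k (random_window n \<epsilon> \<omega>)} \<ge> 1 - exp (- t))"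
proof (intro conjI allI impI)
  fix n k :: nat
  assume "prime n" "5 \<le> n" "0 < k" "real k < (sqrt (real n) + 1) / 2"
  then show "bp_recovers_all_sparse n k (alltop_window n)"
    by (rule alltop_recovery)
next
  fix n k :: nat and t :: real and M :: "'w measure" and \<epsilon> :: "nat \<Rightarrow> 'w \<Rightarrow> complex"
  assume "0 < n" "even n" "0 < k" "0 < t" "prob_space M"
    and "prob_space.indep_vars M (\<lambda>_. borel) \<epsilon> {..<n}"
    and "\<forall>q<n. distr M borel (\<epsilon> q) = torus_uniform"
    and "real k \<le> 1 / 4 * sqrt (real n / (2 * ln (real n) + ln 4 + t)) + 1 / 2"
  then show "measure M {\<omega> \<in> space M. bp_recovers_all_sparse n k (random_window n \<epsilon> \<omega>)} \<ge> 1 - exp (- t)"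
    by (intro random_window_recovery)
qed

end
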